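(* Fix $\vartheta>0$ and let $H_n^{(\vartheta)}$ be the height of a Hoppe tree with parameter $\vartheta$ and $n$ nodes. Let $M_n:=\mathbb{E}[H_n^{(1)}]$ be the expected height of a random recursive tree with $n$ nodes. Then for all $\alpha<\frac{1}{3e}$ and $\beta<\frac{1}{2e}$ there exist constants $C_\alpha,C_\beta>0$ such that for all $t>0$ (and all $n\ge 1$) $$\mathbb{P}\left(H_n^{(\vartheta)}-M_n\geq t \right) \leq C_\beta e^{-\beta t},\qquad \mathbb{P}\left(H_n^{(\vartheta)}-M_n\leq -t \right) \leq C_\alpha e^{-\alpha t}.$$ The constant $C_\beta$ can be chosen independently of $\vartheta$.
   Context: Hoppe tree with parameter $\vartheta>0$: the tree is grown by successive insertion of nodes. Initially there is only the root. In each step a parent node is chosen among the existing nodes, independently of the past, with probability proportional to its weight, where the root has weight $\vartheta$ and every other node has weight $1$; a new node is attached as a child of the chosen node. The Hoppe tree with $n$ nodes is the tree after $n-1$ insertions. For $\vartheta=1$ this is the random recursive tree. The height of a tree is the maximal distance of a node to the root. *)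

theory Defs
  imports "HOL-Probability.Probability"
begin

text \<open>A recursive tree with nodes 0,...,m is encoded by the list ps of length m,
  where ps ! (v-1) is the parent of node v (v \<ge> 1); node 0 is the root and
  every parent has a smaller label than its child.\<close>

text \<open>Choice of the parent among m existing nodes 0..m-1: the root has weight
  theta, every other node weight 1.\<close>
definition hoppe_parent :: "real \<Rightarrow> nat \<Rightarrow> nat pmf" where
  "hoppe_parent \<theta> m =
     bind_pmf (bernoulli_pmf (\<theta> / (\<theta> + real m - 1)))
       (\<lambda>b. if b then return_pmf 0 else pmf_of_set {1..<m})"

primrec hoppe_parents :: "real \<Rightarrow> nat \<Rightarrow> nat list pmf" where
  "hoppe_parents \<theta> 0 = return_pmf []"
| "hoppe_parents \<theta> (Suc k) =
     bind_pmf (hoppe_parents \<theta> k) (\<lambda>ps. map_pmf (\<lambda>j. ps @ [j]) (hoppe_parent \<theta> (Suc k)))"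

fun depth_fuel :: "nat \<Rightarrow> nat list \<Rightarrow> nat \<Rightarrow> nat" where
  "depth_fuel 0 ps v = 0"
| "depth_fuel (Suc f) ps v = (if v = 0 then 0 else Suc (depth_fuel f ps (ps ! (v - 1))))"

definition node_depth :: "nat list \<Rightarrow> nat \<Rightarrow> nat" where
  "node_depth ps v = depth_fuel v ps v"

definition tree_height :: "nat \<Rightarrow> nat list \<Rightarrow> nat" where
  "tree_height n ps = Max (node_depth ps ` {..<n})"

definition hoppe_height :: "real \<Rightarrow> nat \<Rightarrow> nat pmf" where
  "hoppe_height \<theta> n = map_pmf (tree_height n) (hoppe_parents \<theta> (n - 1))"

definition rrt_mean_height :: "nat \<Rightarrow> real" where
  "rrt_mean_height n = measure_pmf.expectation (hoppe_height 1 n) real"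

end

theory Submission
  imports Defs "HOL-Analysis.FPS_Convergence"
begin

text \<open>Let F k t be the probability that a Yule tree, where every node gives birth at rate 1, has height
  less than k at time t; it satisfies F (k + 1)' = - F (k + 1) * (1 - F k) and is a geometric mixture
  over n of the distribution functions of the height of the random recursive tree with n nodes.
  Fix q and let T k be the time when F (k + 1) equals q. Time-shifted profiles F (k + 1) (t + a) and
  F k t cross at most once, so F (k + 2) (T k) is nonincreasing in k. Together with the first moment
  bound 1 - F k t \<le> exp (exp 1 * t - k) this forces T (k + 1) - T k \<ge> (1 - q) / exp 1. Around T k the
  differential equation gives 1 - F (k + 1) t = O(exp (t - T k)) on the left and
  F (k + 1) t \<le> exp (- (1 - q) * (t - T k)) on the right. Taking t = ln n, the height of the random
  recursive tree with n nodes has exponential tails of rates (1 - q) / e and (1 - q)^2 / e around an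
  integer, which is then within a constant of the mean; q = 1/3 suffices. The height is stochastically
  decreasing in the weight of the root, which gives the upper tail for all weights from the limit
  weight 0 and reduces the lower tail to integer weights.\<close>

section \<open>Recursive trees as parent lists, and the depths of their nodes\<close>

definition parent_lists :: "nat \<Rightarrow> nat list set" where
  "parent_lists m = {ps. length ps = m \<and> (\<forall>i<m. ps ! i \<le> i)}"

lemma parent_lists_0 [simp]: "parent_lists 0 = {[]}"
  by (auto simp: parent_lists_def)

lemma append_in_parent_lists: "ps \<in> parent_lists m \<Longrightarrow> j \<le> m \<Longrightarrow> ps @ [j] \<in> parent_lists (Suc m)"
  by (auto simp: parent_lists_def nth_append less_Suc_eq)

lemma length_parent_lists: "ps \<in> parent_lists m \<Longrightarrow> length ps = m"
  by (simp add: parent_lists_def)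

lemma finite_parent_lists [simp]: "finite (parent_lists m)"
proof (rule finite_subset)
  show "parent_lists m \<subseteq> {ps. set ps \<subseteq> {..m} \<and> length ps = m}"
    by (fastforce simp: parent_lists_def in_set_conv_nth)
qed (simp add: finite_lists_length_eq)

text \<open>Each recursive call moves to a strictly smaller label, so fuel \<open>v\<close> always
  suffices and only the first \<open>v\<close> entries of the list are read.\<close>

lemma depth_fuel_cong:
  assumes "v \<le> f" "v \<le> f'" "\<And>i. i < v \<Longrightarrow> ps ! i \<le> i \<and> qs ! i = ps ! i"
  shows "depth_fuel f ps v = depth_fuel f' qs v"
  using assms
proof (induction f arbitrary: f' v)
  case 0
  then show ?case by (cases f') auto
next
  case (Suc f)
  show ?case
  proof (cases "v = 0")
    case True
    then show ?thesis by (cases f') auto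
  next
    case False
    then obtain g where g: "f' = Suc g"
      using Suc.prems(2) by (cases f') auto
    have p: "ps ! (v - 1) \<le> v - 1" "qs ! (v - 1) = ps ! (v - 1)"
      using Suc.prems(3)[of "v - 1"] False by auto
    have "depth_fuel f ps (ps ! (v - 1)) = depth_fuel g qs (ps ! (v - 1))"
    proof (rule Suc.IH)
      fix i assume "i < ps ! (v - 1)"
      then show "ps ! i \<le> i \<and> qs ! i = ps ! i"
        using p(1) Suc.prems(3)[of i] by linarith
    qed (use Suc.prems p g False in linarith)+
    then show ?thesis
      using False g p by simp
  qed
qed

lemma node_depth_0 [simp]: "node_depth ps 0 = 0"
  by (simp add: node_depth_def)

lemma node_depth_append:
  assumes "ps \<in> parent_lists m" "v \<le> m"
  shows "node_depth (ps @ [j]) v = node_depth ps v"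
  unfolding node_depth_def
  by (rule depth_fuel_cong) (use assms in \<open>auto simp: parent_lists_def nth_append\<close>)

lemma node_depth_last:
  assumes "ps \<in> parent_lists m" "j \<le> m"
  shows "node_depth (ps @ [j]) (Suc m) = Suc (node_depth ps j)"
proof -
  have "node_depth (ps @ [j]) (Suc m) = Suc (depth_fuel m (ps @ [j]) j)"
    using assms by (auto simp: node_depth_def parent_lists_def)
  also have "depth_fuel m (ps @ [j]) j = node_depth ps j"
    unfolding node_depth_def
    by (rule depth_fuel_cong) (use assms in \<open>auto simp: parent_lists_def nth_append\<close>)
  finally show ?thesis .
qed

definition below :: "nat \<Rightarrow> nat list \<Rightarrow> bool" where
  "below k ps \<longleftrightarrow> (\<forall>v\<le>length ps. node_depth ps v < k)"

lemma below_append: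
  assumes "ps \<in> parent_lists m" "below k (ps @ [j])"
  shows "below k ps"
  unfolding below_def
proof (intro allI impI)
  fix v assume "v \<le> length ps"
  then show "node_depth ps v < k"
    using assms node_depth_append[OF assms(1), of v j]
    by (auto simp: below_def parent_lists_def dest: spec[of _ v])
qed

lemma tree_height_less_iff: "tree_height (Suc (length ps)) ps < k \<longleftrightarrow> below k ps"
  by (auto simp: tree_height_def below_def lessThan_Suc_atMost Max_less_iff)

section \<open>The law of the Hoppe tree and of its height\<close>

lemma hoppe_parent_bounds: "\<theta> > 0 \<Longrightarrow> 0 \<le> \<theta> / (\<theta> + real m) \<and> \<theta> / (\<theta> + real m) \<le> 1"
  by (auto simp: field_simps)

text \<open>The Bernoulli parameter is 1 here, so the branch with the ill-defined uniform law on an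
  empty set has probability 0.\<close>

lemma hoppe_parent_1: "\<theta> > 0 \<Longrightarrow> hoppe_parent \<theta> (Suc 0) = return_pmf 0"
proof -
  assume "\<theta> > 0"
  have "bernoulli_pmf (1::real) = return_pmf True"
    by (rule pmf_eqI) (case_tac i; simp add: pmf_return)
  then show ?thesis
    using \<open>\<theta> > 0\<close> by (simp add: hoppe_parent_def bind_return_pmf)
qed

lemma set_hoppe_parent: "\<theta> > 0 \<Longrightarrow> set_pmf (hoppe_parent \<theta> (Suc m)) \<subseteq> {..m}"
proof (cases "m = 0")
  case False
  then show ?thesis
    by (auto simp: hoppe_parent_def set_pmf_of_set split: if_splits)
qed (simp add: hoppe_parent_1)

lemma expectation_hoppe_parent:
  fixes g :: "nat \<Rightarrow> real"
  assumes "\<theta> > 0"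
  shows "measure_pmf.expectation (hoppe_parent \<theta> (Suc m)) g =
    (\<theta> * g 0 + (\<Sum>j=1..m. g j)) / (\<theta> + real m)"
proof (cases "m = 0")
  case True
  then show ?thesis using assms by (simp add: hoppe_parent_1)
next
  case False
  have *: "{Suc 0..<Suc m} = {1..m}" by auto
  have "measure_pmf.expectation (hoppe_parent \<theta> (Suc m)) g =
      (\<Sum>b\<in>{True,False}. pmf (bernoulli_pmf (\<theta> / (\<theta> + real m))) b *\<^sub>R
        measure_pmf.expectation (if b then return_pmf 0 else pmf_of_set {1..<Suc m}) g)"
    unfolding hoppe_parent_def using False
    by (subst pmf_expectation_bind[where A="{True,False}"]) auto
  also have "\<dots> = \<theta> / (\<theta> + real m) * g 0 + (1 - \<theta> / (\<theta> + real m)) * ((\<Sum>j=1..m. g j) / real m)"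
    using False hoppe_parent_bounds[OF assms, of m] by (simp add: integral_pmf_of_set *)
  also have "1 - \<theta> / (\<theta> + real m) = real m / (\<theta> + real m)"
    using assms by (simp add: field_simps)
  finally show ?thesis
    using assms False by (simp add: add_divide_distrib)
qed

lemma set_hoppe_parents: "\<theta> > 0 \<Longrightarrow> set_pmf (hoppe_parents \<theta> m) \<subseteq> parent_lists m"
proof (induction m)
  case (Suc m)
  then show ?case
    using set_hoppe_parent[of \<theta> m] by (fastforce intro: append_in_parent_lists)
qed simp

abbreviation hoppe_mean :: "real \<Rightarrow> nat \<Rightarrow> (nat list \<Rightarrow> real) \<Rightarrow> real" where
  "hoppe_mean \<theta> m f \<equiv> measure_pmf.expectation (hoppe_parents \<theta> m) f"

text \<open>The support is finite, which turns expectations into finite sums free of integrability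
  conditions.\<close>

lemma hoppe_mean_sum:
  "\<theta> > 0 \<Longrightarrow> hoppe_mean \<theta> m f = (\<Sum>ps\<in>parent_lists m. pmf (hoppe_parents \<theta> m) ps * f ps)"
  using set_hoppe_parents[of \<theta> m]
  by (subst integral_measure_pmf_real[where A="parent_lists m"]) (auto simp: mult.commute)

lemma hoppe_mean_mono:
  assumes "\<theta> > 0" "\<And>ps. ps \<in> parent_lists m \<Longrightarrow> f ps \<le> g ps"
  shows "hoppe_mean \<theta> m f \<le> hoppe_mean \<theta> m g"
  using assms by (simp add: hoppe_mean_sum sum_mono mult_left_mono)

lemma hoppe_mean_cong:
  assumes "\<theta> > 0" "\<And>ps. ps \<in> parent_lists m \<Longrightarrow> f ps = g ps"
  shows "hoppe_mean \<theta> m f = hoppe_mean \<theta> m g"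
  using assms by (simp add: hoppe_mean_sum)

text \<open>The conditional expectation of \<open>f\<close> after one more insertion, given the
  present tree \<open>ps\<close>.\<close>

definition parent_avg :: "real \<Rightarrow> (nat list \<Rightarrow> real) \<Rightarrow> nat list \<Rightarrow> real" where
  "parent_avg \<theta> f ps =
     (\<theta> * f (ps @ [0]) + (\<Sum>j=1..length ps. f (ps @ [j]))) / (\<theta> + real (length ps))"

lemma hoppe_mean_Suc:
  assumes "\<theta> > 0"
  shows "hoppe_mean \<theta> (Suc m) f = hoppe_mean \<theta> m (parent_avg \<theta> f)"
proof -
  have fin: "finite (set_pmf (hoppe_parent \<theta> (Suc m)))"
    using set_hoppe_parent[OF assms, of m] finite_subset by blast
  have "hoppe_mean \<theta> (Suc m) f =
     (\<Sum>ps\<in>parent_lists m. pmf (hoppe_parents \<theta> m) ps *\<^sub>R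
        measure_pmf.expectation (map_pmf (\<lambda>j. ps @ [j]) (hoppe_parent \<theta> (Suc m))) f)"
    unfolding hoppe_parents.simps
    by (subst pmf_expectation_bind[where A="parent_lists m"])
      (use set_hoppe_parents[OF assms, of m] fin in auto)
  also have "\<dots> = (\<Sum>ps\<in>parent_lists m. pmf (hoppe_parents \<theta> m) ps * parent_avg \<theta> f ps)"
    using assms by (intro sum.cong) (auto simp: expectation_hoppe_parent parent_avg_def length_parent_lists)
  finally show ?thesis
    using assms by (simp add: hoppe_mean_sum)
qed

lemma parent_avg_const: "\<theta> > 0 \<Longrightarrow> parent_avg \<theta> (\<lambda>_. c) ps = c"
  by (simp add: parent_avg_def field_simps add_divide_distrib[symmetric])

lemma parent_avg_mono:
  assumes "\<theta> > 0" "ps \<in> parent_lists m" "\<And>j. j \<le> m \<Longrightarrow> f (ps @ [j]) \<le> g (ps @ [j])"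
  shows "parent_avg \<theta> f ps \<le> parent_avg \<theta> g ps"
  unfolding parent_avg_def
  by (intro divide_right_mono add_mono mult_left_mono sum_mono) (use assms in \<open>auto simp: parent_lists_def\<close>)

text \<open>The tree after m insertions has m + 1 nodes, and the inequality height < k is strict.\<close>

definition height_cdf :: "real \<Rightarrow> nat \<Rightarrow> nat \<Rightarrow> real" where
  "height_cdf \<theta> m k = hoppe_mean \<theta> m (\<lambda>ps. of_bool (below k ps))"

lemma prob_hoppe_height:
  assumes "\<theta> > 0"
  shows "measure_pmf.prob (hoppe_height \<theta> (Suc m)) {h. h < k} = height_cdf \<theta> m k"
proof -
  have "measure_pmf.prob (hoppe_height \<theta> (Suc m)) {h. h < k} =
      measure_pmf.expectation (hoppe_parents \<theta> m) (indicator {ps. tree_height (Suc m) ps < k})"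
    by (simp add: hoppe_height_def vimage_def)
  also have "\<dots> = height_cdf \<theta> m k"
    unfolding height_cdf_def
    by (rule hoppe_mean_cong[OF assms])
      (auto simp: indicator_def tree_height_less_iff[symmetric] length_parent_lists)
  finally show ?thesis .
qed

lemma height_cdf_bounds: "\<theta> > 0 \<Longrightarrow> 0 \<le> height_cdf \<theta> m k" "\<theta> > 0 \<Longrightarrow> height_cdf \<theta> m k \<le> 1"
  using prob_hoppe_height[of \<theta> m k] by (simp_all flip: prob_hoppe_height)

lemma height_cdf_mono: "\<theta> > 0 \<Longrightarrow> k \<le> k' \<Longrightarrow> height_cdf \<theta> m k \<le> height_cdf \<theta> m k'"
  unfolding height_cdf_def by (rule hoppe_mean_mono) (auto simp: below_def of_bool_def)

text \<open>Insertion keeps all old depths, so a tree that fits below \<open>k\<close> afterwards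
  did so before.\<close>

lemma height_cdf_Suc_le:
  assumes "\<theta> > 0" shows "height_cdf \<theta> (Suc m) k \<le> height_cdf \<theta> m k"
  unfolding height_cdf_def hoppe_mean_Suc[OF assms]
proof (rule hoppe_mean_mono[OF assms])
  fix ps assume ps: "ps \<in> parent_lists m"
  have "parent_avg \<theta> (\<lambda>ps. of_bool (below k ps)) ps \<le> parent_avg \<theta> (\<lambda>_. of_bool (below k ps)) ps"
    by (rule parent_avg_mono[OF assms ps]) (use below_append[OF ps] in \<open>auto simp: of_bool_def\<close>)
  then show "parent_avg \<theta> (\<lambda>ps. of_bool (below k ps)) ps \<le> of_bool (below k ps)"
    by (simp only: parent_avg_const[OF assms])
qed

lemma height_cdf_antimono:
  assumes "\<theta> > 0" "m \<le> m'" shows "height_cdf \<theta> m' k \<le> height_cdf \<theta> m k"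
  using lift_Suc_antimono_le[of "\<lambda>m. height_cdf \<theta> m k" m m'] assms height_cdf_Suc_le by simp

lemma height_cdf_0: "height_cdf \<theta> m 0 = 0"
proof -
  have "\<not> below 0 ps" for ps by (auto simp: below_def)
  then show ?thesis by (simp add: height_cdf_def)
qed

text \<open>The extreme case is a path. This bound truncates the sum for the mean height.\<close>

lemma below_large: "ps \<in> parent_lists m \<Longrightarrow> below (Suc m) ps"
proof (induction m arbitrary: ps)
  case 0
  then show ?case by (simp add: below_def)
next
  case (Suc m)
  define qs j where "qs = butlast ps" and "j = last ps"
  have ne: "ps \<noteq> []" using Suc.prems by (auto simp: parent_lists_def)
  have ps: "ps = qs @ [j]" using ne by (simp add: qs_def j_def)
  have qs: "qs \<in> parent_lists m" "j \<le> m"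
    using Suc.prems ps by (auto simp: parent_lists_def nth_append less_Suc_eq dest: spec[of _ m] split: if_splits)
  have "node_depth ps v < Suc (Suc m)" if "v \<le> Suc m" for v
    using that Suc.IH[OF qs(1)] qs node_depth_append[OF qs(1), of v j] node_depth_last[OF qs]
    by (cases "v = Suc m") (auto simp: below_def ps length_parent_lists less_SucI)
  then show ?case
    using Suc.prems by (simp add: below_def length_parent_lists)
qed

lemma height_cdf_1: "\<theta> > 0 \<Longrightarrow> m < k \<Longrightarrow> height_cdf \<theta> m k = 1"
proof -
  assume *: "\<theta> > 0" "m < k"
  have "height_cdf \<theta> m k = hoppe_mean \<theta> m (\<lambda>_. 1)"
    unfolding height_cdf_def
  proof (rule hoppe_mean_cong[OF *(1)])
    fix ps assume "ps \<in> parent_lists m"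
    then have "below k ps"
      using below_large[of ps m] * by (fastforce simp: below_def)
    then show "of_bool (below k ps) = (1::real)" by simp
  qed
  then show ?thesis by simp
qed

section \<open>Stochastic monotonicity in the weight of the root\<close>

text \<open>The depths alone determine the law of the next depth, and they can be compared
  entrywise; the comparison of different root weights therefore runs on depth lists.\<close>

definition depths :: "nat list \<Rightarrow> nat list" where
  "depths ps = map (node_depth ps) [0..<Suc (length ps)]"

lemma length_depths [simp]: "length (depths ps) = Suc (length ps)"
  by (simp add: depths_def)

lemma depths_append:
  assumes "ps \<in> parent_lists m" "j \<le> m"
  shows "depths (ps @ [j]) = depths ps @ [Suc (depths ps ! j)]"
proof -
  have "depths ps ! j = node_depth ps j"
    using assms by (simp add: depths_def length_parent_lists del: upt_Suc)
  then show ?thesis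
    using assms by (simp add: depths_def length_parent_lists node_depth_append node_depth_last)
qed

lemma depths_0: "depths ps ! 0 = 0"
  by (simp add: depths_def del: upt_Suc)

text \<open>This is \<open>parent_avg\<close> for depth lists: a child of the root has depth
  \<open>Suc 0\<close>, and \<open>length ds - 1\<close> counts the nodes other than the
  root.\<close>

definition depth_avg :: "real \<Rightarrow> (nat list \<Rightarrow> real) \<Rightarrow> nat list \<Rightarrow> real" where
  "depth_avg \<theta> g ds =
     (\<theta> * g (ds @ [Suc 0]) + (\<Sum>j=1..length ds - 1. g (ds @ [Suc (ds ! j)]))) / (\<theta> + real (length ds - 1))"

lemma parent_avg_depths:
  assumes "ps \<in> parent_lists m"
  shows "parent_avg \<theta> (\<lambda>ps. g (depths ps)) ps = depth_avg \<theta> g (depths ps)"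
proof -
  have "depths (ps @ [j]) = depths ps @ [Suc (depths ps ! j)]" if "j \<le> length ps" for j
    using depths_append[OF assms] that assms by (simp add: length_parent_lists)
  then show ?thesis
    by (simp add: parent_avg_def depth_avg_def depths_0)
qed

definition depth_antimono :: "(nat list \<Rightarrow> real) \<Rightarrow> bool" where
  "depth_antimono g \<longleftrightarrow> (\<forall>ds es. list_all2 (\<le>) ds es \<longrightarrow> g es \<le> g ds)"

lemma depth_antimonoD: "depth_antimono g \<Longrightarrow> list_all2 (\<le>) ds es \<Longrightarrow> g es \<le> g ds"
  by (simp add: depth_antimono_def)

text \<open>If both trees attach the new node to the same label, entrywise domination of the depths
  survives.\<close>

lemma depth_antimono_avg:
  assumes "\<theta> > 0" "depth_antimono g"
  shows "depth_antimono (depth_avg \<theta> g)"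
  unfolding depth_antimono_def
proof (intro allI impI)
  fix ds es :: "nat list" assume le: "list_all2 (\<le>) ds es"
  have len: "length ds = length es" using le by (rule list_all2_lengthD)
  have "g (es @ [Suc 0]) \<le> g (ds @ [Suc 0])"
    by (rule depth_antimonoD[OF assms(2)]) (use le in \<open>auto intro: list_all2_appendI\<close>)
  moreover have "g (es @ [Suc (es ! j)]) \<le> g (ds @ [Suc (ds ! j)])" if "j \<in> {1..length es - 1}" for j
  proof (rule depth_antimonoD[OF assms(2)])
    have "ds ! j \<le> es ! j" by (rule list_all2_nthD[OF le]) (use that len in auto)
    then show "list_all2 (\<le>) (ds @ [Suc (ds ! j)]) (es @ [Suc (es ! j)])"
      using le by (auto intro: list_all2_appendI)
  qed
  ultimately show "depth_avg \<theta> g es \<le> depth_avg \<theta> g ds"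
    unfolding depth_avg_def len using assms(1)
    by (intro divide_right_mono add_mono mult_left_mono sum_mono) auto
qed

text \<open>A larger root weight moves probability to the root, where the new node gets depth 1, the
  smallest possible, so that \<open>g\<close> is largest.\<close>

lemma depth_avg_theta_mono:
  assumes "0 < \<theta>" "\<theta> \<le> \<theta>'" "depth_antimono g"
  shows "depth_avg \<theta> g ds \<le> depth_avg \<theta>' g ds"
proof -
  define a S m where "a = g (ds @ [Suc 0])"
    and "S = (\<Sum>j=1..length ds - 1. g (ds @ [Suc (ds ! j)]))" and "m = real (length ds - 1)"
  have "S \<le> (\<Sum>j=1..length ds - 1. a)"
    unfolding S_def a_def
    by (intro sum_mono depth_antimonoD[OF assms(3)]) (auto intro!: list_all2_appendI list_all2_refl)
  then have "S \<le> m * a" by (simp add: m_def)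
  then have "(\<theta>' - \<theta>) * S \<le> (\<theta>' - \<theta>) * (m * a)"
    using assms(2) by (intro mult_left_mono) auto
  then have "(\<theta> * a + S) * (\<theta>' + m) \<le> (\<theta>' * a + S) * (\<theta> + m)"
    by (simp add: algebra_simps)
  moreover have "0 < \<theta> + m" "0 < \<theta>' + m" using assms by (auto simp: m_def)
  ultimately have "(\<theta> * a + S) / (\<theta> + m) \<le> (\<theta>' * a + S) / (\<theta>' + m)"
    by (simp add: divide_le_eq le_divide_eq field_simps)
  then show ?thesis by (simp add: depth_avg_def a_def S_def m_def)
qed

lemma hoppe_mean_theta_mono:
  assumes "0 < \<theta>" "\<theta> \<le> \<theta>'" "depth_antimono g"
  shows "hoppe_mean \<theta> m (\<lambda>ps. g (depths ps)) \<le> hoppe_mean \<theta>' m (\<lambda>ps. g (depths ps))"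
  using assms(3)
proof (induction m arbitrary: g)
  case (Suc m)
  have pos: "0 < \<theta>'" using assms by simp
  have "hoppe_mean \<theta> (Suc m) (\<lambda>ps. g (depths ps)) = hoppe_mean \<theta> m (\<lambda>ps. depth_avg \<theta> g (depths ps))"
    unfolding hoppe_mean_Suc[OF assms(1)]
    by (rule hoppe_mean_cong[OF assms(1)]) (rule parent_avg_depths)
  \<comment> \<open>The weight changes first in the earlier insertions, then in the last
    one.\<close>
  also have "\<dots> \<le> hoppe_mean \<theta>' m (\<lambda>ps. depth_avg \<theta> g (depths ps))"
    by (rule Suc.IH) (rule depth_antimono_avg[OF assms(1) Suc.prems])
  also have "\<dots> \<le> hoppe_mean \<theta>' m (\<lambda>ps. depth_avg \<theta>' g (depths ps))"
    by (rule hoppe_mean_mono[OF pos]) (rule depth_avg_theta_mono[OF assms(1,2) Suc.prems])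
  also have "\<dots> = hoppe_mean \<theta>' (Suc m) (\<lambda>ps. g (depths ps))"
    unfolding hoppe_mean_Suc[OF pos]
    by (rule hoppe_mean_cong[OF pos]) (rule parent_avg_depths[symmetric])
  finally show ?case .
qed simp

lemma below_depths: "below k ps \<longleftrightarrow> (\<forall>d\<in>set (depths ps). d < k)"
  by (auto simp: below_def depths_def less_Suc_eq_le simp del: upt_Suc)

lemma height_cdf_theta_mono:
  assumes "0 < \<theta>" "\<theta> \<le> \<theta>'"
  shows "height_cdf \<theta> m k \<le> height_cdf \<theta>' m k"
  unfolding height_cdf_def below_depths
proof (rule hoppe_mean_theta_mono[OF assms])
  show "depth_antimono (\<lambda>ds. of_bool (\<forall>d\<in>set ds. d < k))"
    unfolding depth_antimono_def
  proof (intro allI impI)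
    fix ds es :: "nat list" assume le: "list_all2 (\<le>) ds es"
    have "d < k" if *: "\<forall>e\<in>set es. e < k" "d \<in> set ds" for d
    proof -
      obtain i where i: "i < length ds" "d = ds ! i" using *(2) by (auto simp: in_set_conv_nth)
      then have "d \<le> es ! i" "es ! i \<in> set es" using le by (auto simp: list_all2_conv_all_nth)
      then show ?thesis using *(1) by fastforce
    qed
    then show "of_bool (\<forall>d\<in>set es. d < k) \<le> (of_bool (\<forall>d\<in>set ds. d < k) :: real)"
      by (auto simp: of_bool_def)
  qed
qed

section \<open>Generating functions of the height\<close>

unbundle no vec_syntax
unbundle fps_syntax

text \<open>The solution of \<open>Z' = Z * A\<close> with \<open>Z $ 0 = 1\<close>; the composition
  makes sense because the integral has constant coefficient 0.\<close>

definition fps_exp_integral :: "real fps \<Rightarrow> real fps" where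
  "fps_exp_integral A = fps_exp 1 oo fps_integral0 A"

lemma fps_exp_integral_nth_0 [simp]: "fps_exp_integral A $ 0 = 1"
  by (simp add: fps_exp_integral_def)

lemma fps_deriv_exp_integral: "fps_deriv (fps_exp_integral A) = fps_exp_integral A * A"
  by (simp add: fps_exp_integral_def fps_compose_deriv fps_deriv_fps_integral)

text \<open>Coefficient m will be the probability that a random recursive tree with m + 1 nodes has height
  less than k.\<close>

primrec height_fps :: "nat \<Rightarrow> real fps" where
  "height_fps 0 = 0"
| "height_fps (Suc k) = fps_exp_integral (height_fps k)"

lemma height_fps_nth_0: "height_fps k $ 0 = of_bool (0 < k)"
  by (cases k) auto

text \<open>The truncated \<open>k - 1\<close> is harmless: at \<open>k = 0\<close> both sides are
  0.\<close>

lemma fps_deriv_height_fps: "fps_deriv (height_fps k) = height_fps k * height_fps (k - 1)"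
  by (cases k) (auto simp: fps_deriv_exp_integral)

lemma fps_deriv_prod_log:
  fixes f :: "'a \<Rightarrow> real fps"
  assumes "finite S" "\<And>v. v \<in> S \<Longrightarrow> fps_deriv (f v) = f v * g v"
  shows "fps_deriv (prod f S) = prod f S * sum g S"
  using assms by (induction S rule: finite_induct) (auto simp: algebra_simps)

lemma fps_nth_0_prod:
  fixes f :: "'a \<Rightarrow> real fps"
  shows "finite S \<Longrightarrow> prod f S $ 0 = (\<Prod>v\<in>S. f v $ 0)"
  by (induction S rule: finite_induct) auto

text \<open>Differentiating this weight sums it over all ways to attach one more node, so the i-th derivative
  at 0 for the one-node tree counts the trees after i insertions that have height less than K.
  Nodes at depth K or more contribute the factor height_fps 0 = 0 through the truncated subtraction.\<close>

definition tree_weight :: "real fps \<Rightarrow> nat \<Rightarrow> nat list \<Rightarrow> real fps" where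
  "tree_weight Z K ps = Z * (\<Prod>v=1..length ps. height_fps (K - node_depth ps v))"

lemma tree_weight_append:
  assumes "ps \<in> parent_lists m" "j \<le> m"
  shows "tree_weight Z K (ps @ [j]) = tree_weight Z K ps * height_fps (K - node_depth ps j - 1)"
proof -
  have len: "length ps = m" using assms(1) by (rule length_parent_lists)
  have "(\<Prod>v=1..Suc m. height_fps (K - node_depth (ps @ [j]) v)) =
      (\<Prod>v=1..m. height_fps (K - node_depth (ps @ [j]) v)) * height_fps (K - Suc (node_depth ps j))"
    by (simp add: node_depth_last[OF assms])
  also have "(\<Prod>v=1..m. height_fps (K - node_depth (ps @ [j]) v)) = (\<Prod>v=1..m. height_fps (K - node_depth ps v))"
    by (rule prod.cong) (auto simp: node_depth_append[OF assms(1)])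
  finally show ?thesis by (simp add: tree_weight_def len mult.assoc)
qed

text \<open>In the product rule each node \<open>v\<close> contributes the factor
  \<open>height_fps (K - node_depth ps v - 1)\<close>, which is that of a new child of
  \<open>v\<close>; the equation for \<open>Z\<close> does the same for the root with multiplicity
  \<open>\<theta>\<close>.\<close>

lemma fps_deriv_tree_weight:
  assumes "ps \<in> parent_lists m" and Z: "fps_deriv Z = fps_const \<theta> * height_fps (K - 1) * Z"
  shows "fps_deriv (tree_weight Z K ps) =
    fps_const \<theta> * tree_weight Z K (ps @ [0]) + (\<Sum>j=1..m. tree_weight Z K (ps @ [j]))"
proof -
  have len: "length ps = m" using assms(1) by (rule length_parent_lists)
  define P where "P = (\<Prod>v=1..m. height_fps (K - node_depth ps v))"
  have P: "fps_deriv P = P * (\<Sum>v=1..m. height_fps (K - node_depth ps v - 1))"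
    unfolding P_def by (rule fps_deriv_prod_log) (auto simp: fps_deriv_height_fps)
  have "fps_deriv (Z * P) = fps_const \<theta> * (Z * P * height_fps (K - 1)) +
      (\<Sum>v=1..m. Z * P * height_fps (K - node_depth ps v - 1))"
    by (simp add: P Z algebra_simps sum_distrib_left)
  moreover have "tree_weight Z K ps = Z * P"
    by (simp add: tree_weight_def P_def len)
  ultimately show ?thesis
    by (simp add: tree_weight_append[OF assms(1)])
qed

lemma tree_weight_nth_0:
  assumes "0 < K" "Z $ 0 = 1"
  shows "tree_weight Z K ps $ 0 = of_bool (below K ps)"
proof -
  have "tree_weight Z K ps $ 0 = (\<Prod>v=1..length ps. of_bool (node_depth ps v < K))"
    by (simp add: tree_weight_def assms fps_nth_0_prod height_fps_nth_0)
  also have "\<dots> = of_bool (\<forall>v\<in>{1..length ps}. node_depth ps v < K)"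
    by (auto simp: of_bool_def prod_eq_1_iff intro!: prod_zero)
  also have "(\<forall>v\<in>{1..length ps}. node_depth ps v < K) \<longleftrightarrow> below K ps"
  proof
    assume *: "\<forall>v\<in>{1..length ps}. node_depth ps v < K"
    have "node_depth ps v < K" if "v \<le> length ps" for v
      using * that assms(1) by (cases "v = 0") auto
    then show "below K ps" by (simp add: below_def)
  qed (simp add: below_def)
  finally show ?thesis .
qed

text \<open>Averaged over the random tree, the derivative identity becomes a recursion that trades
  one degree of the coefficient for one more insertion. It starts at the one-node tree, whose weight
  is \<open>Z\<close>, and ends at constant coefficients, which are indicators of small
  height.\<close>

theorem height_cdf_genfun:
  assumes \<theta>: "\<theta> > 0" and Z: "Z $ 0 = 1" "fps_deriv Z = fps_const \<theta> * height_fps k * Z"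
  shows "Z $ i = pochhammer \<theta> i / fact i * height_cdf \<theta> i (Suc k)"
proof -
  define a where "a = (\<lambda>m i. hoppe_mean \<theta> m (\<lambda>ps. tree_weight Z (Suc k) ps $ i))"
  have step: "real (Suc i) * a m (Suc i) = (\<theta> + real m) * a (Suc m) i" for m i
  proof -
    have "real (Suc i) * a m (Suc i) =
        hoppe_mean \<theta> m (\<lambda>ps. fps_deriv (tree_weight Z (Suc k) ps) $ i)"
      by (simp add: a_def)
    also have "\<dots> = hoppe_mean \<theta> m
        (\<lambda>ps. (\<theta> + real m) * parent_avg \<theta> (\<lambda>ps. tree_weight Z (Suc k) ps $ i) ps)"
    proof (rule hoppe_mean_cong[OF \<theta>])
      fix ps assume ps: "ps \<in> parent_lists m"
      have "fps_deriv (tree_weight Z (Suc k) ps) $ i = \<theta> * tree_weight Z (Suc k) (ps @ [0]) $ i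
          + (\<Sum>j=1..m. tree_weight Z (Suc k) (ps @ [j]) $ i)"
        by (subst fps_deriv_tree_weight[OF ps, where \<theta>=\<theta>]) (use Z in \<open>simp_all add: fps_sum_nth\<close>)
      then show "fps_deriv (tree_weight Z (Suc k) ps) $ i =
          (\<theta> + real m) * parent_avg \<theta> (\<lambda>ps. tree_weight Z (Suc k) ps $ i) ps"
        using \<theta> by (simp add: parent_avg_def length_parent_lists[OF ps] add_pos_nonneg less_imp_neq[symmetric])
    qed
    also have "\<dots> = (\<theta> + real m) * a (Suc m) i"
      unfolding a_def hoppe_mean_Suc[OF \<theta>] by simp
    finally show ?thesis .
  qed
  \<comment> \<open>Each use of \<open>step\<close> contributes a factor
    \<open>\<theta> + real m\<close> and raises \<open>m\<close> by one, which builds up the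
    Pochhammer symbol.\<close>
  have "fact i * a m i = pochhammer (\<theta> + real m) i * a (m + i) 0" for m i
  proof (induction i arbitrary: m)
    case (Suc i)
    have "fact (Suc i) * a m (Suc i) = fact i * (real (Suc i) * a m (Suc i))"
      by simp
    also have "\<dots> = (\<theta> + real m) * (fact i * a (Suc m) i)"
      by (simp only: step mult.left_commute)
    also have "\<dots> = pochhammer (\<theta> + real m) (Suc i) * a (m + Suc i) 0"
      by (simp only: Suc.IH pochhammer_rec) (simp add: algebra_simps)
    finally show ?case .
  qed simp
  from this[of i 0] have "fact i * Z $ i = pochhammer \<theta> i * a i 0"
    by (simp add: a_def tree_weight_def)
  also have "a i 0 = height_cdf \<theta> i (Suc k)"
    by (simp add: a_def height_cdf_def tree_weight_nth_0 Z)
  finally show ?thesis by (simp add: field_simps)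
qed

lemma height_fps_nth: "height_fps k $ i = height_cdf 1 i k"
proof (cases k)
  case (Suc k')
  have "height_fps (Suc k') $ i = pochhammer 1 i / fact i * height_cdf 1 i (Suc k')"
    by (rule height_cdf_genfun) (simp_all add: fps_deriv_exp_integral mult.commute)
  then show ?thesis by (simp add: Suc pochhammer_fact[symmetric])
qed (simp add: height_cdf_0)

text \<open>Raising to the power \<open>r\<close> multiplies the logarithmic derivative by
  \<open>r\<close>, which gives the equation for root weight \<open>r\<close>.\<close>

lemma height_fps_power_nth:
  assumes "0 < r"
  shows "(height_fps (Suc k) ^ r) $ i = pochhammer (real r) i / fact i * height_cdf (real r) i (Suc k)"
proof (rule height_cdf_genfun)
  have "height_fps (Suc k) * height_fps (Suc k) ^ (r - 1) = height_fps (Suc k) ^ r"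
    using assms by (cases r) auto
  then show "fps_deriv (height_fps (Suc k) ^ r) = fps_const (real r) * height_fps k * height_fps (Suc k) ^ r"
    by (simp add: fps_deriv_power fps_deriv_exp_integral fps_of_nat[symmetric] mult_ac)
qed (use assms in \<open>auto simp: fps_nth_power_0\<close>)

text \<open>The left-hand side is the probability that only the first of the non-root nodes is attached
  to the root and the tree hanging from it has height less than k.\<close>

lemma height_cdf_lower:
  assumes "\<theta> > 0"
  shows "fact i * height_cdf 1 i k / pochhammer (\<theta> + 1) i \<le> height_cdf \<theta> (Suc i) (Suc k)"
proof -
  define Z where "Z = fps_exp_integral (fps_const \<theta> * height_fps k)"
  have Z: "Z $ n = pochhammer \<theta> n / fact n * height_cdf \<theta> n (Suc k)" for n
    unfolding Z_def
    by (rule height_cdf_genfun) (simp_all add: assms fps_deriv_exp_integral mult.commute)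
  have Z_nonneg: "Z $ n \<ge> 0" for n
    using height_cdf_bounds(1)[OF assms, of n "Suc k"] assms by (auto simp: Z pochhammer_nonneg)
  have "\<theta> * height_cdf 1 i k = Z $ 0 * (fps_const \<theta> * height_fps k) $ i"
    by (simp add: Z_def height_fps_nth)
  also have "\<dots> \<le> (Z * (fps_const \<theta> * height_fps k)) $ i"
  proof -
    have "0 \<le> (fps_const \<theta> * height_fps k) $ n" for n
      using assms height_cdf_bounds(1)[of 1 n k] by (simp add: height_fps_nth)
    \<comment> \<open>All coefficients are nonnegative, so the summand \<open>j = 0\<close> of the
      Cauchy product is a lower bound.\<close>
    then have "Z $ 0 * (fps_const \<theta> * height_fps k) $ (i - 0) \<le> (\<Sum>j=0..i. Z $ j * (fps_const \<theta> * height_fps k) $ (i - j))"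
      using Z_nonneg by (intro member_le_sum[where f="\<lambda>j. Z $ j * (fps_const \<theta> * height_fps k) $ (i - j)"]) auto
    then show ?thesis by (simp add: fps_mult_nth[of Z])
  qed
  also have "\<dots> = real (Suc i) * Z $ Suc i"
  proof -
    have "Z * (fps_const \<theta> * height_fps k) = fps_deriv Z" by (simp add: Z_def fps_deriv_exp_integral)
    then show ?thesis by simp
  qed
  also have "\<dots> = \<theta> * pochhammer (\<theta> + 1) i / fact i * height_cdf \<theta> (Suc i) (Suc k)"
    unfolding Z pochhammer_rec fact_Suc by (simp del: of_nat_Suc)
  finally show ?thesis
    using assms pochhammer_pos[of "\<theta> + 1" i] by (simp add: field_simps)
qed

text \<open>As the root weight tends to 0, the tree becomes a random recursive tree hung from the
  root by one edge: the bound of \<open>height_cdf_lower\<close> tends to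
  \<open>height_cdf 1 i k\<close>. Monotonicity in the weight carries it from small weights to
  \<open>\<theta>\<close>.\<close>

lemma height_cdf_theta_lower:
  assumes "\<theta> > 0"
  shows "height_cdf 1 i k \<le> height_cdf \<theta> (Suc i) (Suc k)"
proof (rule tendsto_upperbound)
  have "isCont (\<lambda>x::real. fact i * height_cdf 1 i k / pochhammer (x + 1) i) 0"
    unfolding pochhammer_prod by (intro continuous_intros) auto
  then show "((\<lambda>x. fact i * height_cdf 1 i k / pochhammer (x + 1) i) \<longlongrightarrow> height_cdf 1 i k) (at_right 0)"
    by (auto simp: isCont_def pochhammer_fact[symmetric] intro: filterlim_at_within_not_equal tendsto_mono[OF at_le])
  show "\<forall>\<^sub>F x in at_right 0. fact i * height_cdf 1 i k / pochhammer (x + 1) i \<le> height_cdf \<theta> (Suc i) (Suc k)"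
    using eventually_at_right_less[of 0] eventually_at_right_real[OF assms]
  proof eventually_elim
    case (elim x)
    then show ?case
      using height_cdf_lower[of x i k] height_cdf_theta_mono[of x \<theta> "Suc i" "Suc k"] by auto
  qed
qed simp

section \<open>The height of the Yule tree\<close>

text \<open>The number of nodes of the Yule tree at time t is geometric with parameter exp (- t).\<close>

definition yule_cdf :: "nat \<Rightarrow> real \<Rightarrow> real" where
  "yule_cdf k t = exp (- t) * eval_fps (height_fps k) (1 - exp (- t))"

lemma height_fps_nth_bounds: "0 \<le> height_fps k $ i" "height_fps k $ i \<le> 1"
  by (simp_all add: height_fps_nth height_cdf_bounds)

lemma summable_height_fps:
  fixes x :: real
  assumes "0 \<le> x" "x < 1"
  shows "summable (\<lambda>i. height_fps k $ i * x ^ i)"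
proof (rule summable_comparison_test)
  show "\<exists>N. \<forall>n\<ge>N. norm (height_fps k $ n * x ^ n) \<le> x ^ n"
    using height_fps_nth_bounds assms by (auto simp: abs_mult intro!: mult_left_le_one_le)
qed (use assms in \<open>auto intro: summable_geometric\<close>)

lemma fps_conv_radius_height_fps: "fps_conv_radius (height_fps k) \<ge> 1"
  unfolding fps_conv_radius_def
  by (rule conv_radius_geI_ex') (use summable_height_fps[of _ k] in \<open>auto simp: one_ereal_def\<close>)

lemma height_fps_conv:
  fixes x :: real
  assumes "0 \<le> x" "x < 1"
  shows "ereal (norm x) < fps_conv_radius (height_fps k)"
proof -
  have "ereal (norm x) < 1" using assms by (simp add: one_ereal_def)
  then show ?thesis using fps_conv_radius_height_fps by (rule less_le_trans)
qed

lemma exp_unit: "0 \<le> t \<Longrightarrow> 0 \<le> 1 - exp (- t)" "0 \<le> t \<Longrightarrow> 1 - exp (- t) < (1::real)"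
  by auto

lemma yule_cdf_0 [simp]: "yule_cdf 0 t = 0"
  by (simp add: yule_cdf_def)

lemma yule_cdf_Suc_at_0 [simp]: "yule_cdf (Suc k) 0 = 1"
  by (simp add: yule_cdf_def eval_fps_at_0)

text \<open>The prefactor \<open>exp (- t)\<close> contributes \<open>- yule_cdf (Suc k) t\<close>;
  the chain rule supplies a second \<open>exp (- t)\<close>, which completes the product of the two
  profiles.\<close>

lemma yule_cdf_deriv:
  assumes "0 \<le> t"
  shows "(yule_cdf (Suc k) has_real_derivative - yule_cdf (Suc k) t * (1 - yule_cdf k t)) (at t)"
proof -
  let ?x = "1 - exp (- t)"
  have "(eval_fps (height_fps (Suc k)) has_real_derivative eval_fps (fps_deriv (height_fps (Suc k))) ?x) (at ?x)"
    by (rule has_field_derivative_eval_fps) (rule height_fps_conv[OF exp_unit[OF assms]])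
  also have "eval_fps (fps_deriv (height_fps (Suc k))) ?x = eval_fps (height_fps (Suc k)) ?x * eval_fps (height_fps k) ?x"
    unfolding fps_deriv_height_fps diff_Suc_1 by (intro eval_fps_mult height_fps_conv exp_unit assms)
  finally have "((\<lambda>t. eval_fps (height_fps (Suc k)) (1 - exp (- t))) has_real_derivative
      eval_fps (height_fps (Suc k)) ?x * eval_fps (height_fps k) ?x * exp (- t)) (at t)"
    by (rule DERIV_chain2) (auto intro!: derivative_eq_intros)
  then show ?thesis
    unfolding yule_cdf_def by (auto intro!: derivative_eq_intros simp: algebra_simps)
qed

lemma yule_cdf_bounds:
  assumes "0 \<le> t"
  shows "0 \<le> yule_cdf k t" "yule_cdf k t \<le> 1" "0 < yule_cdf (Suc k) t" "yule_cdf k t \<le> yule_cdf (Suc k) t"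
proof -
  let ?x = "1 - exp (- t)"
  note x = exp_unit[OF assms]
  note sm = summable_height_fps[OF x]
  show nonneg: "0 \<le> yule_cdf k t"
    unfolding yule_cdf_def eval_fps_def using x height_fps_nth_bounds
    by (intro mult_nonneg_nonneg suminf_nonneg sm) auto
  have "eval_fps (height_fps k) ?x \<le> (\<Sum>i. ?x ^ i)"
    unfolding eval_fps_def using x height_fps_nth_bounds
    by (intro suminf_le sm summable_geometric) (auto intro!: mult_left_le_one_le)
  also have "\<dots> = exp t"
    using x by (subst suminf_geometric) (auto simp: exp_minus field_simps)
  finally have "yule_cdf k t \<le> exp (- t) * exp t"
    unfolding yule_cdf_def by (intro mult_left_mono) auto
  then show "yule_cdf k t \<le> 1" by (simp flip: exp_add)
  have "0 < eval_fps (height_fps (Suc k)) ?x"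
    unfolding eval_fps_def using x height_fps_nth_bounds
    by (intro suminf_pos2[where i=0] sm) (auto simp: height_fps_nth_0 simp del: height_fps.simps)
  then show "0 < yule_cdf (Suc k) t" by (simp add: yule_cdf_def)
  have "eval_fps (height_fps k) ?x \<le> eval_fps (height_fps (Suc k)) ?x"
    unfolding eval_fps_def using x
    by (intro suminf_le sm mult_right_mono) (auto simp: height_fps_nth height_cdf_mono simp del: height_fps.simps)
  then show "yule_cdf k t \<le> yule_cdf (Suc k) t" by (simp add: yule_cdf_def)
qed

lemma yule_cdf_antimono:
  assumes "0 \<le> s" "s \<le> t"
  shows "yule_cdf k t \<le> yule_cdf k s"
proof (cases k)
  case (Suc k')
  show ?thesis unfolding Suc
  proof (rule DERIV_nonpos_imp_nonincreasing[OF assms(2)])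
    fix x assume "s \<le> x" "x \<le> t"
    then show "\<exists>y. (yule_cdf (Suc k') has_real_derivative y) (at x) \<and> y \<le> 0"
      using yule_cdf_deriv[of x k'] yule_cdf_bounds[of x k'] assms
      by (intro exI[of _ "- yule_cdf (Suc k') x * (1 - yule_cdf k' x)"])
        (auto simp: mult_nonneg_nonneg less_imp_le)
  qed
qed simp

text \<open>One minus the left-hand side is at most the expected number of nodes at distance k from the
  root, t ^ k / fact k.\<close>

lemma yule_cdf_first_moment:
  assumes "0 \<le> t"
  shows "1 - yule_cdf k t \<le> exp (exp 1 * t - real k)"
  using assms
proof (induction k arbitrary: t)
  case 0
  then show ?case by simp
next
  case (Suc k)
  define h where "h = (\<lambda>t. 1 - yule_cdf (Suc k) t - exp (exp 1 * t - real (Suc k)))"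
  have "h t \<le> h 0"
  proof (rule DERIV_nonpos_imp_nonincreasing[OF Suc.prems])
    fix x :: real assume x: "0 \<le> x" "x \<le> t"
    have "yule_cdf (Suc k) x * (1 - yule_cdf k x) \<le> 1 - yule_cdf k x"
      using yule_cdf_bounds[OF x(1)] by (intro mult_left_le_one_le) (auto intro: less_imp_le)
    also have "\<dots> \<le> exp (exp 1 * x - real k)" by (rule Suc.IH[OF x(1)])
    \<comment> \<open>Going down one level costs a factor \<open>exp 1\<close>, which is what
      differentiating the bound in time produces.\<close>
    also have "\<dots> = exp 1 * exp (exp 1 * x - real (Suc k))"
      by (simp flip: exp_add)
    finally show "\<exists>y. (h has_real_derivative y) (at x) \<and> y \<le> 0"
      unfolding h_def
      by (intro exI[of _ "yule_cdf (Suc k) x * (1 - yule_cdf k x) - exp 1 * exp (exp 1 * x - real (Suc k))"])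
        (auto intro!: derivative_eq_intros yule_cdf_deriv[OF x(1)])
  qed
  also have "h 0 \<le> 0" by (simp add: h_def)
  finally show ?case by (simp add: h_def)
qed

text \<open>By induction on k, time-shifted profiles of consecutive levels cross at most
  once, since the logarithm of their quotient has as derivative the difference one level below.\<close>

lemma yule_cdf_log_ratio_deriv:
  assumes "0 \<le> a" "0 \<le> t"
  shows "((\<lambda>t. ln (yule_cdf (Suc (Suc k)) (t + a)) - ln (yule_cdf (Suc k) t)) has_real_derivative
    yule_cdf (Suc k) (t + a) - yule_cdf k t) (at t)"
proof -
  have pos: "0 < yule_cdf (Suc (Suc k)) (t + a)" "0 < yule_cdf (Suc k) t"
    using assms by (auto intro: yule_cdf_bounds(3))
  have 1: "((\<lambda>t. yule_cdf (Suc (Suc k)) (t + a)) has_real_derivative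
      - yule_cdf (Suc (Suc k)) (t + a) * (1 - yule_cdf (Suc k) (t + a))) (at t)"
    using yule_cdf_deriv[of "t + a" "Suc k"] assms by (simp add: DERIV_shift)
  show ?thesis
    using pos yule_cdf_deriv[OF assms(2), of k]
    by (auto intro!: derivative_eq_intros 1 simp: field_simps)
qed

lemma yule_cdf_log_ratio_at_0: "0 \<le> a \<Longrightarrow> ln (yule_cdf (Suc (Suc k)) (0 + a)) - ln (yule_cdf (Suc k) 0) \<le> 0"
  using yule_cdf_bounds[of a "Suc (Suc k)"] yule_cdf_bounds(3)[of a "Suc k"] by simp

lemma yule_cdf_crossing:
  assumes "0 \<le> a" "0 \<le> s" "s \<le> t" "yule_cdf k s < yule_cdf (Suc k) (s + a)"
  shows "yule_cdf k t < yule_cdf (Suc k) (t + a)"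
  using assms(2-)
proof (induction k arbitrary: s t)
  case 0
  then show ?case using yule_cdf_bounds(3)[of "t + a" 0] assms(1) by simp
next
  case (Suc k)
  define D where "D = (\<lambda>t. ln (yule_cdf (Suc (Suc k)) (t + a)) - ln (yule_cdf (Suc k) t))"
  have D': "(D has_real_derivative yule_cdf (Suc k) (x + a) - yule_cdf k x) (at x)" if "0 \<le> x" for x
    unfolding D_def by (rule yule_cdf_log_ratio_deriv[OF assms(1) that])
  have D_pos: "0 < D x \<longleftrightarrow> yule_cdf (Suc k) x < yule_cdf (Suc (Suc k)) (x + a)" if "0 \<le> x" for x
    using that assms(1) yule_cdf_bounds(3)[of "x + a" "Suc k"] yule_cdf_bounds(3)[of x k] by (simp add: D_def)
  have Ds: "0 < D s" using Suc.prems D_pos by simp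
  have D0: "D 0 \<le> 0" unfolding D_def by (rule yule_cdf_log_ratio_at_0[OF assms(1)])
  have "s \<noteq> 0" using Ds D0 by auto
  then have "0 < s" using Suc.prems by simp
  \<comment> \<open>From \<open>D 0 \<le> 0 < D s\<close> the mean value theorem gives a time before
    \<open>s\<close> at which \<open>D\<close> has positive derivative. By the induction hypothesis
    the derivative stays positive from then on, so \<open>D\<close> does not decrease after
    \<open>s\<close>.\<close>
  then obtain z where z: "0 < z" "z < s" "D s - D 0 = (s - 0) * (yule_cdf (Suc k) (z + a) - yule_cdf k z)"
    using MVT2[of 0 s D "\<lambda>x. yule_cdf (Suc k) (x + a) - yule_cdf k x"] D' by auto
  have "0 < (s - 0) * (yule_cdf (Suc k) (z + a) - yule_cdf k z)" using z(3) Ds D0 by linarith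
  then have "yule_cdf k z < yule_cdf (Suc k) (z + a)" using \<open>0 < s\<close> by (simp add: zero_less_mult_iff)
  then have up: "yule_cdf k x < yule_cdf (Suc k) (x + a)" if "z \<le> x" for x
    using Suc.IH[of z x] that z by simp
  have "D s \<le> D t"
  proof (rule DERIV_nonneg_imp_nondecreasing[OF Suc.prems(2)])
    fix x assume "s \<le> x" "x \<le> t"
    then show "\<exists>y. (D has_real_derivative y) (at x) \<and> 0 \<le> y"
      using D'[of x] up[of x] z by (intro exI[of _ "yule_cdf (Suc k) (x + a) - yule_cdf k x"]) auto
  qed
  then show ?case using Ds D_pos[of t] Suc.prems by simp
qed

section \<open>Decay of the profiles and spacing of the level times\<close>

text \<open>A Gronwall argument: level \<open>k\<close> stays at most \<open>q\<close> after time
  \<open>s\<close>, so level \<open>Suc k\<close> decays at rate at least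
  \<open>1 - q\<close>.\<close>

lemma yule_cdf_upper_step:
  assumes "0 \<le> s" "s \<le> t" "yule_cdf k s \<le> q"
  shows "yule_cdf (Suc k) t \<le> yule_cdf (Suc k) s * exp (- (1 - q) * (t - s))"
proof -
  define h where "h = (\<lambda>t. exp ((1 - q) * (t - s)) * yule_cdf (Suc k) t)"
  have "h t \<le> h s"
  proof (rule DERIV_nonpos_imp_nonincreasing[OF assms(2)])
    fix x assume x: "s \<le> x" "x \<le> t"
    have "yule_cdf k x \<le> q" using yule_cdf_antimono[OF assms(1) x(1), of k] assms(3) by simp
    then have "exp ((1 - q) * (x - s)) * yule_cdf (Suc k) x * (yule_cdf k x - q) \<le> 0"
      using yule_cdf_bounds(3)[of x k] assms(1) x by (intro mult_nonneg_nonpos) auto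
    moreover have "(h has_real_derivative exp ((1 - q) * (x - s)) * yule_cdf (Suc k) x * (yule_cdf k x - q)) (at x)"
      unfolding h_def using yule_cdf_deriv[of x k] assms(1) x
      by (auto intro!: derivative_eq_intros simp: algebra_simps)
    ultimately show "\<exists>y. (h has_real_derivative y) (at x) \<and> y \<le> 0" by blast
  qed
  moreover define c where "c = (1 - q) * (t - s)"
  ultimately have "exp c * yule_cdf (Suc k) t \<le> yule_cdf (Suc k) s" by (simp add: h_def)
  moreover have "- (1 - q) * (t - s) = - c" by (simp add: c_def algebra_simps)
  ultimately show ?thesis by (simp only: exp_minus) (simp add: field_simps)
qed

text \<open>The decay rate \<open>1 - yule_cdf k t\<close> never exceeds 1.\<close>

lemma yule_cdf_lower_step:
  assumes "0 \<le> s" "s \<le> t"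
  shows "yule_cdf (Suc k) s * exp (- (t - s)) \<le> yule_cdf (Suc k) t"
proof -
  define h where "h = (\<lambda>t. exp (t - s) * yule_cdf (Suc k) t)"
  have "h s \<le> h t"
  proof (rule DERIV_nonneg_imp_nondecreasing[OF assms(2)])
    fix x assume x: "s \<le> x" "x \<le> t"
    have "0 \<le> exp (x - s) * yule_cdf (Suc k) x * yule_cdf k x"
      using yule_cdf_bounds[of x] assms(1) x by (intro mult_nonneg_nonneg) auto
    moreover have "(h has_real_derivative exp (x - s) * yule_cdf (Suc k) x * yule_cdf k x) (at x)"
      unfolding h_def using yule_cdf_deriv[of x k] assms(1) x
      by (auto intro!: derivative_eq_intros simp: algebra_simps)
    ultimately show "\<exists>y. (h has_real_derivative y) (at x) \<and> 0 \<le> y" by blast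
  qed
  moreover define c where "c = t - s"
  ultimately have "yule_cdf (Suc k) s \<le> exp c * yule_cdf (Suc k) t" by (simp add: h_def)
  then show ?thesis unfolding c_def[symmetric] by (simp add: exp_minus field_simps)
qed

lemma yule_cdf_level_exists:
  assumes q: "0 < q" "q < 1" and s: "0 \<le> s" "yule_cdf k s \<le> q" "q \<le> yule_cdf (Suc k) s"
  shows "\<exists>t\<ge>s. yule_cdf (Suc k) t = q"
proof -
  \<comment> \<open>Decay at rate \<open>1 - q\<close> from \<open>s\<close> to \<open>T\<close>
    amounts to exactly the factor \<open>q\<close>.\<close>
  define T where "T = s + ln (1 / q) / (1 - q)"
  have T: "s \<le> T" using q by (simp add: T_def)
  have "(1 - q) * (T - s) = - ln q" using q by (simp add: T_def ln_div)
  then have "- (1 - q) * (T - s) = ln q" by (simp add: algebra_simps)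
  then have "yule_cdf (Suc k) T \<le> yule_cdf (Suc k) s * q"
    using yule_cdf_upper_step[OF s(1) T s(2)] q by simp
  also have "\<dots> \<le> q" using yule_cdf_bounds[OF s(1), of "Suc k"] q by (intro mult_left_le_one_le) auto
  finally have "yule_cdf (Suc k) T \<le> q" .
  moreover have "continuous_on {s..T} (yule_cdf (Suc k))"
    using s(1) by (intro continuous_at_imp_continuous_on ballI DERIV_isCont[OF yule_cdf_deriv]) auto
  ultimately show ?thesis
    using IVT2'[of "yule_cdf (Suc k)" T q s] s T by auto
qed

text \<open>The time at which the height of the Yule process exceeds k with probability 1 - q.\<close>

locale level_times =
  fixes q :: real and \<tau> :: "nat \<Rightarrow> real"
  assumes q: "0 < q" "q < 1"
    and yule_cdf_level: "yule_cdf (Suc k) (\<tau> k) = q"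
    and level_nonneg: "0 \<le> \<tau> k"
    and level_mono: "\<tau> k \<le> \<tau> (Suc k)"

text \<open>Profiles increase with the level, so at each level time the next profile is still at
  least \<open>q\<close>. The next level time is sought from there on, which makes the sequence
  monotone by construction.\<close>

lemma level_times_exist:
  assumes q: "0 < q" "q < 1"
  shows "\<exists>\<tau>. level_times q \<tau>"
proof -
  have "\<exists>\<tau>. \<forall>k. (0 \<le> \<tau> k \<and> yule_cdf (Suc k) (\<tau> k) = q) \<and> \<tau> k \<le> \<tau> (Suc k)"
  proof (rule dependent_nat_choice)
    show "\<exists>t\<ge>0. yule_cdf (Suc 0) t = q"
      by (rule yule_cdf_level_exists) (use q in auto)
  next
    fix t k assume t: "0 \<le> t \<and> yule_cdf (Suc k) t = q"
    then obtain u where "t \<le> u" "yule_cdf (Suc (Suc k)) u = q"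
      using yule_cdf_level_exists[OF q, of t "Suc k"] yule_cdf_bounds(4)[of t "Suc k"] by auto
    then show "\<exists>u. (0 \<le> u \<and> yule_cdf (Suc (Suc k)) u = q) \<and> t \<le> u"
      using t by (intro exI[of _ u]) auto
  qed
  then show ?thesis using q by (auto simp: level_times_def)
qed

context level_times
begin

text \<open>At the level time the profile equals \<open>q\<close> and the one below it is at most
  \<open>q\<close>, so decay at rate \<open>1 - q\<close> has set in.\<close>

lemma yule_cdf_after_level:
  assumes "\<tau> k \<le> t"
  shows "yule_cdf (Suc k) t \<le> exp (- (1 - q) * (t - \<tau> k))"
proof -
  have "yule_cdf k (\<tau> k) \<le> q" using yule_cdf_bounds(4)[OF level_nonneg, of k k] yule_cdf_level by simp
  from yule_cdf_upper_step[OF level_nonneg assms this]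
  have "yule_cdf (Suc k) t \<le> q * exp (- (1 - q) * (t - \<tau> k))" by (simp add: yule_cdf_level)
  also have "\<dots> \<le> 1 * exp (- (1 - q) * (t - \<tau> k))" using q by (intro mult_right_mono) auto
  finally show ?thesis by simp
qed

text \<open>The odds (1 - F) / F grow at least as fast as in the logistic equation.\<close>

lemma yule_cdf_before_level:
  assumes "0 \<le> t" "t \<le> \<tau> k"
  shows "1 - yule_cdf (Suc k) t \<le> 1 / q * exp (t - \<tau> k)"
proof -
  define h where "h = (\<lambda>t. exp (- t) * (1 / yule_cdf (Suc k) t - 1))"
  have "h t \<le> h (\<tau> k)"
  proof (rule DERIV_nonneg_imp_nondecreasing[OF assms(2)])
    fix x assume "t \<le> x" "x \<le> \<tau> k"
    then have x: "0 \<le> x" using assms by simp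
    have pos: "0 < yule_cdf (Suc k) x" by (rule yule_cdf_bounds(3)[OF x])
    have "(h has_real_derivative exp (- x) * ((yule_cdf (Suc k) x - yule_cdf k x) / yule_cdf (Suc k) x)) (at x)"
      unfolding h_def using pos
      by (auto intro!: derivative_eq_intros yule_cdf_deriv[OF x] simp: field_simps)
    moreover have "0 \<le> exp (- x) * ((yule_cdf (Suc k) x - yule_cdf k x) / yule_cdf (Suc k) x)"
      using pos yule_cdf_bounds(4)[OF x, of k] by simp
    ultimately show "\<exists>y. (h has_real_derivative y) (at x) \<and> 0 \<le> y" by blast
  qed
  also have "h (\<tau> k) \<le> exp (- \<tau> k) * (1 / q)" by (simp add: h_def yule_cdf_level right_diff_distrib)
  finally have "1 / yule_cdf (Suc k) t - 1 \<le> exp t * (exp (- \<tau> k) * (1 / q))"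
    by (simp add: h_def exp_minus field_simps)
  also have "\<dots> = 1 / q * exp (t - \<tau> k)" by (simp add: exp_diff exp_minus field_simps)
  finally have *: "1 / yule_cdf (Suc k) t - 1 \<le> 1 / q * exp (t - \<tau> k)" .
  have "1 - yule_cdf (Suc k) t \<le> (1 - yule_cdf (Suc k) t) / yule_cdf (Suc k) t"
    using yule_cdf_bounds(2)[OF assms(1), of "Suc k"] yule_cdf_bounds(3)[OF assms(1), of k]
    by (simp add: le_divide_eq mult_left_le)
  also have "\<dots> = 1 / yule_cdf (Suc k) t - 1"
    using yule_cdf_bounds(3)[OF assms(1), of k] by (simp add: diff_divide_distrib)
  finally show ?thesis using * by simp
qed

text \<open>The shift \<open>a\<close> aligns two consecutive profiles at their value
  \<open>q\<close>. An earlier strict crossing would persist up to \<open>\<tau> k\<close>, where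
  they agree; hence the log ratio one level higher does not increase up to \<open>\<tau> k\<close>,
  and it starts nonpositive.\<close>

lemma yule_cdf_next_level_antimono:
  "yule_cdf (Suc (Suc (Suc k))) (\<tau> (Suc k)) \<le> yule_cdf (Suc (Suc k)) (\<tau> k)"
proof -
  define a where "a = \<tau> (Suc k) - \<tau> k"
  have a: "0 \<le> a" "\<tau> k + a = \<tau> (Suc k)" using level_mono[of k] by (auto simp: a_def)
  define D where "D = (\<lambda>t. ln (yule_cdf (Suc (Suc (Suc k))) (t + a)) - ln (yule_cdf (Suc (Suc k)) t))"
  have no_crossing: "yule_cdf (Suc (Suc k)) (x + a) \<le> yule_cdf (Suc k) x" if "0 \<le> x" "x \<le> \<tau> k" for x
    using yule_cdf_crossing[OF a(1) that, of "Suc k"] yule_cdf_level[of k] yule_cdf_level[of "Suc k"] a(2) by force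
  have "D (\<tau> k) \<le> D 0"
  proof (rule DERIV_nonpos_imp_nonincreasing[OF level_nonneg])
    fix x assume x: "0 \<le> x" "x \<le> \<tau> k"
    show "\<exists>y. (D has_real_derivative y) (at x) \<and> y \<le> 0"
      using yule_cdf_log_ratio_deriv[OF a(1) x(1), of "Suc k"] no_crossing[OF x]
      by (intro exI[of _ "yule_cdf (Suc (Suc k)) (x + a) - yule_cdf (Suc k) x"]) (auto simp: D_def)
  qed
  also have "D 0 \<le> 0" unfolding D_def by (rule yule_cdf_log_ratio_at_0[OF a(1)])
  finally have "ln (yule_cdf (Suc (Suc (Suc k))) (\<tau> (Suc k))) \<le> ln (yule_cdf (Suc (Suc k)) (\<tau> k))"
    by (simp add: D_def a(2))
  then show ?thesis
    using yule_cdf_bounds(3)[OF level_nonneg, of "Suc (Suc k)" "Suc k"] yule_cdf_bounds(3)[OF level_nonneg, of "Suc k" k]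
    by simp
qed

text \<open>A gap shorter than (1 - q) / e would bound all later gaps strictly below 1 / e, which
  contradicts the first moment bound.\<close>

lemma level_gap: "(1 - q) / exp 1 \<le> \<tau> (Suc k) - \<tau> k"
proof (rule ccontr)
  define a where "a = (\<lambda>k. \<tau> (Suc k) - \<tau> k)"
  define r where "r = (\<lambda>k. yule_cdf (Suc (Suc k)) (\<tau> k))"
  assume "\<not> (1 - q) / exp 1 \<le> \<tau> (Suc k) - \<tau> k"
  then have small: "a k < (1 - q) / exp 1" by (simp add: a_def)
  define b where "b = a k / (1 - q)"
  have eb: "exp 1 * b < 1" using small q by (simp add: b_def field_simps)
  have r_pos: "0 < r l" for l unfolding r_def by (rule yule_cdf_bounds(3)[OF level_nonneg])
  \<comment> \<open>Between consecutive level times the next profile falls from \<open>r l\<close>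
    to \<open>q\<close>, at a rate between \<open>1 - q\<close> and 1. The slow rate for gap
    \<open>l\<close>, the fast rate for gap \<open>k\<close> and \<open>r l \<le> r k\<close>
    together give \<open>(1 - q) * a l \<le> a k\<close>.\<close>
  have gap: "a l \<le> b" if "k \<le> l" for l
  proof -
    have "q \<le> r l * exp (- (1 - q) * a l)"
      using yule_cdf_upper_step[OF level_nonneg level_mono, of "Suc l" l q] yule_cdf_level[of "Suc l"] yule_cdf_level[of l]
      by (simp add: a_def r_def)
    also have "\<dots> \<le> r k * exp (- (1 - q) * a l)"
      using lift_Suc_antimono_le[of r k l] that yule_cdf_next_level_antimono by (simp add: r_def)
    finally have 1: "q \<le> r k * exp (- (1 - q) * a l)" .
    have 2: "r k * exp (- a k) \<le> q"
      using yule_cdf_lower_step[OF level_nonneg level_mono, of "Suc k" k] yule_cdf_level[of "Suc k"]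
      by (simp add: a_def r_def)
    have "exp (- a k) \<le> exp (- (1 - q) * a l)"
      using order_trans[OF 2 1] r_pos[of k] by simp
    then have "- a k \<le> - (1 - q) * a l" by (simp only: exp_le_cancel_iff)
    then have "a l * (1 - q) \<le> a k" by (simp add: algebra_simps)
    then show ?thesis using q by (simp add: b_def pos_le_divide_eq)
  qed
  have lin: "\<tau> (k + l) \<le> \<tau> k + real l * b" for l
  proof (induction l)
    case (Suc l)
    have "\<tau> (k + Suc l) = \<tau> (k + l) + a (k + l)" by (simp add: a_def)
    then show ?case using Suc.IH gap[of "k + l"] by (simp add: algebra_simps)
  qed simp
  \<comment> \<open>Since \<open>exp 1 * b < 1\<close>, the exponent in the first moment bound at
    time \<open>\<tau> (k + l)\<close> tends to minus infinity; this \<open>l\<close> pushes the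
    bound below \<open>1 - q\<close>.\<close>
  obtain l :: nat where l: "(exp 1 * \<tau> k - ln (1 - q)) / (1 - exp 1 * b) < real l"
    using reals_Archimedean2 by blast
  have "1 - q = 1 - yule_cdf (Suc (k + l)) (\<tau> (k + l))" by (simp add: yule_cdf_level)
  also have "\<dots> \<le> exp (exp 1 * \<tau> (k + l) - real (Suc (k + l)))"
    by (rule yule_cdf_first_moment[OF level_nonneg])
  finally have "ln (1 - q) \<le> ln (exp (exp 1 * \<tau> (k + l) - real (Suc (k + l))))"
    using q by (subst ln_le_cancel_iff) auto
  also have "\<dots> = exp 1 * \<tau> (k + l) - real (Suc (k + l))" by (rule ln_exp)
  also have "\<dots> \<le> exp 1 * (\<tau> k + real l * b) - real l"
    using lin[of l] by (intro diff_mono mult_left_mono) auto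
  finally have "real l * (1 - exp 1 * b) \<le> exp 1 * \<tau> k - ln (1 - q)"
    by (simp add: algebra_simps)
  then show False using l eb by (simp add: divide_less_eq)
qed

lemma level_gaps:
  assumes "k \<le> l"
  shows "(real l - real k) * ((1 - q) / exp 1) \<le> \<tau> l - \<tau> k"
proof -
  define d where "d = (1 - q) / exp 1"
  have "(real l - real k) * d \<le> \<tau> l - \<tau> k"
    using assms
  proof (induction l rule: dec_induct)
    case (step l)
    then show ?case using level_gap[of l] by (simp add: algebra_simps flip: d_def)
  qed simp
  then show ?thesis by (simp add: d_def)
qed

text \<open>The centre is the first level whose time exceeds \<open>t\<close>. The linear lower
  bound on the spacing of level times converts decay in time into decay in the level.\<close>

lemma yule_cdf_concentrated:
  assumes "0 \<le> t"
  defines "\<delta> \<equiv> (1 - q) / exp 1"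
  shows "\<exists>\<kappa>::nat. \<forall>k. 1 - yule_cdf (Suc k) t \<le> 1 / q * exp (- \<delta> * (real k - real \<kappa>)) \<and>
    yule_cdf (Suc k) t \<le> exp ((1 - q) * \<delta>) * exp (- ((1 - q) * \<delta>) * (real \<kappa> - real k))"
proof -
  have \<delta>: "0 < \<delta>" using q by (simp add: \<delta>_def)
  have "\<exists>k. t < \<tau> k"
  proof -
    obtain l :: nat where "t / \<delta> < real l" using reals_Archimedean2 by blast
    then have "t < real l * \<delta>" using \<delta> by (simp add: divide_less_eq)
    also have "\<dots> \<le> \<tau> l" using level_gaps[of 0 l] level_nonneg[of 0] by (simp add: \<delta>_def)
    finally show ?thesis by blast
  qed
  define \<kappa> where "\<kappa> = (LEAST k. t < \<tau> k)"
  have \<kappa>: "t < \<tau> \<kappa>" unfolding \<kappa>_def by (rule LeastI_ex) fact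
  have below_\<kappa>: "\<tau> k \<le> t" if "k < \<kappa>" for k
    using not_less_Least[of k "\<lambda>k. t < \<tau> k"] that by (simp add: \<kappa>_def)
  have "1 - yule_cdf (Suc k) t \<le> 1 / q * exp (- \<delta> * (real k - real \<kappa>))" for k
  proof (cases "\<kappa> \<le> k")
    case True
    have gap: "(real k - real \<kappa>) * \<delta> \<le> \<tau> k - \<tau> \<kappa>" using level_gaps[OF True] by (simp add: \<delta>_def)
    moreover have "0 \<le> (real k - real \<kappa>) * \<delta>" using True \<delta> by simp
    ultimately have "t \<le> \<tau> k" using \<kappa> by linarith
    then have "1 - yule_cdf (Suc k) t \<le> 1 / q * exp (t - \<tau> k)" by (rule yule_cdf_before_level[OF assms(1)])
    also have "\<dots> \<le> 1 / q * exp (- \<delta> * (real k - real \<kappa>))"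
      using gap \<kappa> q by (intro mult_left_mono) (auto simp: algebra_simps)
    finally show ?thesis .
  next
    \<comment> \<open>Below the centre the right-hand side is at least 1.\<close>
    case False
    have "1 - yule_cdf (Suc k) t \<le> 1" using yule_cdf_bounds(1)[OF assms(1), of "Suc k"] by simp
    also have "1 \<le> 1 / q * exp (- \<delta> * (real k - real \<kappa>))"
    proof -
      have "1 * 1 \<le> 1 / q * exp (- \<delta> * (real k - real \<kappa>))"
        using q \<delta> False by (intro mult_mono) (auto simp: mult_nonneg_nonpos)
      then show ?thesis by simp
    qed
    finally show ?thesis .
  qed
  moreover have "yule_cdf (Suc k) t \<le> exp ((1 - q) * \<delta>) * exp (- ((1 - q) * \<delta>) * (real \<kappa> - real k))" for k
  proof (cases "k < \<kappa>")
    case True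
    \<comment> \<open>The last level with time at most \<open>t\<close> is
      \<open>\<kappa> - 1\<close>; the factor \<open>exp ((1 - q) * \<delta>)\<close> pays for this
      loss of one level.\<close>
    then have "(real (\<kappa> - 1) - real k) * \<delta> \<le> \<tau> (\<kappa> - 1) - \<tau> k"
      using level_gaps[of k "\<kappa> - 1"] by (simp add: \<delta>_def)
    also have "\<dots> \<le> t - \<tau> k" using below_\<kappa>[of "\<kappa> - 1"] True by simp
    finally have "(real \<kappa> - 1 - real k) * \<delta> \<le> t - \<tau> k" using True by (simp add: of_nat_diff)
    then have "(1 - q) * ((real \<kappa> - 1 - real k) * \<delta>) \<le> (1 - q) * (t - \<tau> k)"
      using q by (intro mult_left_mono) auto
    then have "exp (- (1 - q) * (t - \<tau> k)) \<le> exp ((1 - q) * \<delta> - ((1 - q) * \<delta>) * (real \<kappa> - real k))"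
      by (simp add: algebra_simps)
    with yule_cdf_after_level[OF below_\<kappa>[OF True]]
    have "yule_cdf (Suc k) t \<le> exp ((1 - q) * \<delta> - ((1 - q) * \<delta>) * (real \<kappa> - real k))"
      by (rule order_trans)
    then show ?thesis by (simp flip: exp_add)
  next
    case False
    have "yule_cdf (Suc k) t \<le> 1" by (rule yule_cdf_bounds(2)[OF assms(1)])
    also have "1 \<le> exp ((1 - q) * \<delta> + ((1 - q) * \<delta>) * (real k - real \<kappa>))"
      using q \<delta> False by simp
    finally show ?thesis by (simp add: algebra_simps flip: exp_add)
  qed
  ultimately show ?thesis by blast
qed

end

section \<open>From the Yule tree to a fixed number of nodes\<close>

text \<open>For \<open>m > 0\<close> this is \<open>(1 + 1 / m) ^ m \<le> exp 1\<close>. At time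
  \<open>ln (m + 1)\<close> the mixture over sizes is geometric with ratio
  \<open>1 - 1 / (m + 1)\<close>, and its powers up to \<open>m\<close> thus stay above
  \<open>exp (- 1)\<close>.\<close>

lemma exp_neg_1_le_power: "exp (- 1) \<le> (1 - 1 / real (Suc m)) ^ m"
proof (cases m)
  case (Suc m')
  have "1 - 1 / real (Suc m) = inverse (1 + 1 / real m)"
    using Suc by (simp add: field_simps)
  moreover have "(1 + 1 / real m) ^ m \<le> exp (1 / real m) ^ m"
    by (intro power_mono exp_ge_add_one_self) auto
  moreover have "exp (1 / real m) ^ m = exp 1"
    unfolding exp_of_nat_mult[symmetric] using Suc by simp
  ultimately show ?thesis
    by (simp add: exp_minus power_inverse le_imp_inverse_le zero_less_power add_pos_nonneg)
qed simp

lemma exp_neg_ln: "exp (- ln (real (Suc m))) = 1 / real (Suc m)"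
  by (simp add: exp_minus exp_ln inverse_eq_divide del: of_nat_Suc)

text \<open>In the geometric mixture, sizes with at least \<open>m\<close> insertions have mass
  \<open>x ^ m \<ge> exp (- 1)\<close>, and their heights are stochastically at least that for
  \<open>m\<close>.\<close>

lemma height_tail_upper:
  "1 - height_cdf 1 m k \<le> exp 1 * (1 - yule_cdf k (ln (real (Suc m))))"
proof -
  define x where "x = 1 - 1 / real (Suc m)"
  have x: "0 \<le> x" "x < 1" by (auto simp: x_def)
  have yule_eq: "yule_cdf k (ln (real (Suc m))) = (1 - x) * (\<Sum>i. height_fps k $ i * x ^ i)"
    by (simp add: yule_cdf_def exp_neg_ln eval_fps_def x_def del: of_nat_Suc)
  define w where "w = height_cdf 1 m k"
  have w: "0 \<le> w" "w \<le> 1" using height_cdf_bounds[of 1] by (auto simp: w_def)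
  have le: "height_fps k $ i * x ^ i \<le> (if i < m then x ^ i else w * x ^ i)" for i
    using height_fps_nth_bounds[of k i] x height_cdf_antimono[of 1 m i k]
    by (auto simp: height_fps_nth w_def intro!: mult_right_mono mult_left_le_one_le)
  have geo: "(\<lambda>i. x ^ i) sums (1 / (1 - x))" using x by (intro geometric_sums) auto
  \<comment> \<open>The dominating series is the full geometric series minus \<open>1 - w\<close>
    times its tail from index \<open>m\<close> on.\<close>
  have "(\<lambda>i. x ^ i + (if i < m then 0 else - ((1 - w) * x ^ i))) sums
      (1 / (1 - x) + - ((1 - w) * (x ^ m * (1 / (1 - x)))))"
  proof (rule sums_add[OF geo])
    have "(\<lambda>i. - ((1 - w) * (x ^ m * x ^ i))) sums (- ((1 - w) * (x ^ m * (1 / (1 - x)))))"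
      by (intro sums_minus sums_mult geo)
    then have "(\<lambda>i. (\<lambda>i. if i < m then 0 else - ((1 - w) * x ^ i)) (i + m)) sums
        (- ((1 - w) * (x ^ m * (1 / (1 - x)))))"
      by (simp add: power_add mult.commute)
    then show "(\<lambda>i. if i < m then 0 else - ((1 - w) * x ^ i)) sums
        (- ((1 - w) * (x ^ m * (1 / (1 - x)))))"
      by (subst (asm) sums_iff_shift) simp
  qed
  then have s: "(\<lambda>i. if i < m then x ^ i else w * x ^ i) sums ((1 - (1 - w) * x ^ m) / (1 - x))"
    by (rule back_subst[of "\<lambda>f. f sums _", OF back_subst[of "\<lambda>a. _ sums a"]])
      (use x in \<open>auto simp: field_simps fun_eq_iff\<close>)
  have "(\<Sum>i. height_fps k $ i * x ^ i) \<le> (1 - (1 - w) * x ^ m) / (1 - x)"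
    using suminf_le[OF le summable_height_fps[OF x] sums_summable[OF s]] sums_unique[OF s] by simp
  then have "yule_cdf k (ln (real (Suc m))) \<le> 1 - (1 - w) * x ^ m"
    unfolding yule_eq using x by (simp add: pos_le_divide_eq mult.commute)
  moreover have "(1 - w) * exp (- 1) \<le> (1 - w) * x ^ m"
    unfolding x_def using w by (intro mult_left_mono exp_neg_1_le_power) auto
  ultimately have "(1 - w) * exp (- 1) \<le> 1 - yule_cdf k (ln (real (Suc m)))" by linarith
  then show ?thesis by (simp add: w_def exp_minus field_simps)
qed

lemma pochhammer_fact_choose:
  assumes "0 < r"
  shows "pochhammer (real r) i / fact i = real (((r - 1) + i) choose (r - 1))"
proof -
  have "real (((r - 1) + i) choose (r - 1)) = real (((r - 1) + i) choose i)"
    by (subst binomial_symmetric) auto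
  also have "\<dots> = pochhammer (real r) i / fact i"
    using assms by (simp add: binomial_gbinomial gbinomial_pochhammer' of_nat_diff)
  finally show ?thesis ..
qed

text \<open>A Hoppe tree of integer weight r is r random recursive trees with their roots merged, whence the
  power height_fps (Suc k) ^ r.\<close>

lemma height_tail_lower:
  assumes "0 < r"
  shows "height_cdf (real r) m (Suc k) \<le> exp 1 * real r ^ r * yule_cdf (Suc k) (ln (real (Suc m)))"
proof -
  define x where "x = 1 - 1 / real (Suc m)"
  have x: "0 \<le> x" "x < 1" by (auto simp: x_def)
  define y where "y = eval_fps (height_fps (Suc k)) x"
  have yule_eq: "yule_cdf (Suc k) (ln (real (Suc m))) = y / real (Suc m)"
    by (simp add: yule_cdf_def exp_neg_ln y_def x_def del: of_nat_Suc height_fps.simps)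
  define p where "p = height_cdf (real r) m (Suc k)"
  have r: "0 < real r" using assms by simp
  have p: "0 \<le> p" by (simp add: p_def height_cdf_bounds[OF r])
  define c where "c = (\<lambda>i. pochhammer (real r) i / fact i)"
  have c: "0 \<le> c i" for i using r by (simp add: c_def pochhammer_nonneg)
  have conv: "ereal (norm x) < fps_conv_radius (height_fps (Suc k) ^ r)"
    using height_fps_conv[OF x, of "Suc k"] fps_conv_radius_power[of "height_fps (Suc k)" r] by (rule less_le_trans)
  \<comment> \<open>The coefficients \<open>c i\<close> are binomial, and their sum up to
    \<open>m\<close> collapses to \<open>(m + r) choose r\<close>, which is at least
    \<open>((m + r) / r) ^ r\<close>.\<close>
  have "(real (Suc m) / real r) ^ r \<le> (real (m + r) / real r) ^ r"
    using assms by (intro power_mono divide_right_mono) auto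
  also have "\<dots> \<le> real ((m + r) choose r)"
    using binomial_ge_n_over_k_pow_k[of r "m + r", where 'a=real] by simp
  also have "(m + r) choose r = (\<Sum>i\<le>m. ((r - 1) + i) choose (r - 1))"
    using choose_rising_sum(1)[of "r - 1" m] assms by (simp add: add.commute)
  finally have choose: "(real (Suc m) / real r) ^ r \<le> (\<Sum>i\<le>m. c i)"
    using assms by (simp add: c_def pochhammer_fact_choose)
  have "p * exp (- 1) * (real (Suc m) / real r) ^ r \<le> p * exp (- 1) * (\<Sum>i\<le>m. c i)"
    using p choose by (intro mult_left_mono) auto
  also have "\<dots> = (\<Sum>i\<le>m. c i * (p * exp (- 1)))"
    by (simp add: sum_distrib_left mult_ac)
  \<comment> \<open>Smaller trees are lower, and \<open>x ^ i\<close> is at least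
    \<open>exp (- 1)\<close> up to index \<open>m\<close>.\<close>
  also have "\<dots> \<le> (\<Sum>i\<le>m. c i * (height_cdf (real r) i (Suc k) * x ^ i))"
  proof (intro sum_mono mult_left_mono mult_mono c)
    fix i assume i: "i \<in> {..m}"
    show "p \<le> height_cdf (real r) i (Suc k)"
      unfolding p_def using i by (intro height_cdf_antimono r) auto
    have "exp (- 1) \<le> x ^ m" unfolding x_def by (rule exp_neg_1_le_power)
    also have "\<dots> \<le> x ^ i" using i x by (intro power_decreasing) auto
    finally show "exp (- 1) \<le> x ^ i" .
  qed (use r in \<open>auto simp: height_cdf_bounds\<close>)
  also have "\<dots> = (\<Sum>i\<le>m. (height_fps (Suc k) ^ r) $ i * x ^ i)"
    by (simp add: height_fps_power_nth[OF assms] c_def mult.assoc del: height_fps.simps)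
  also have "\<dots> \<le> eval_fps (height_fps (Suc k) ^ r) x"
    unfolding eval_fps_def
  proof (rule sum_le_suminf)
    show "summable (\<lambda>i. (height_fps (Suc k) ^ r) $ i * x ^ i)" by (rule summable_fps[OF conv])
    show "0 \<le> (height_fps (Suc k) ^ r) $ i * x ^ i" for i
      unfolding height_fps_power_nth[OF assms]
      using c[unfolded c_def] height_cdf_bounds(1)[OF r] x by (intro mult_nonneg_nonneg) auto
  qed auto
  also have "\<dots> = y ^ r"
    unfolding y_def by (rule eval_fps_power[OF height_fps_conv[OF x]])
  finally have "p * exp (- 1) * (real (Suc m) / real r) ^ r \<le> y ^ r" .
  then have *: "p \<le> exp 1 * real r ^ r * (y / real (Suc m)) ^ r"
    using r by (simp add: exp_minus power_divide field_simps del: of_nat_Suc)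
  \<comment> \<open>The profile lies in the unit interval, so its power is at most the profile
    itself; the resulting rate is the same for all \<open>r\<close>.\<close>
  have "(y / real (Suc m)) ^ r \<le> (y / real (Suc m)) ^ 1"
    unfolding yule_eq[symmetric] using yule_cdf_bounds(1,2)[of "ln (real (Suc m))" "Suc k"] assms
    by (intro power_decreasing) auto
  then have "exp 1 * real r ^ r * (y / real (Suc m)) ^ r \<le> exp 1 * real r ^ r * yule_cdf (Suc k) (ln (real (Suc m)))"
    unfolding yule_eq by (intro mult_left_mono) auto
  with * show ?thesis unfolding p_def by (rule order_trans)
qed

text \<open>With \<open>q = 1/3\<close> the rates \<open>(1 - q) / exp 1\<close> and
  \<open>(1 - q)^2 / exp 1\<close> become the two constants here, which exceed
  \<open>1 / (2 * exp 1)\<close> and \<open>1 / (3 * exp 1)\<close>. The centre is common to all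
  integer weights \<open>r\<close>.\<close>

lemma height_concentrated:
  obtains A B :: real where "0 < A" "0 < B"
    "\<And>m. \<exists>\<kappa>::nat. \<forall>k. 1 - height_cdf 1 m k \<le> A * exp (- (2 / (3 * exp 1)) * (real k - real \<kappa>)) \<and>
      (\<forall>r>0. height_cdf (real r) m (Suc k) \<le>
        B * real r ^ r * exp (- (4 / (9 * exp 1)) * (real \<kappa> - real k)))"
proof -
  define \<delta> \<gamma> where "\<delta> = 2 / (3 * exp 1 :: real)" and "\<gamma> = 4 / (9 * exp 1 :: real)"
  \<comment> \<open>The factor \<open>exp 1\<close> is the cost of fixing the size, 3 is
    \<open>1 / q\<close>, and \<open>exp \<delta>\<close>, \<open>exp \<gamma>\<close> account for a
    shift by one level.\<close>
  define A B where "A = exp 1 * 3 * exp \<delta>" and "B = exp 1 * exp \<gamma>"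
  obtain \<tau> where \<tau>: "level_times (1 / 3) \<tau>" using level_times_exist[of "1 / 3"] by auto
  have \<delta>: "(1 - 1 / 3) / exp 1 = \<delta>" "(1 - 1 / 3) * \<delta> = \<gamma>" "0 < \<delta>"
    by (auto simp: \<delta>_def \<gamma>_def)
  have "\<exists>\<kappa>::nat. \<forall>k. 1 - height_cdf 1 m k \<le> A * exp (- \<delta> * (real k - real \<kappa>)) \<and>
      (\<forall>r>0. height_cdf (real r) m (Suc k) \<le> B * real r ^ r * exp (- \<gamma> * (real \<kappa> - real k)))" for m
  proof -
    let ?t = "ln (real (Suc m))"
    have "0 \<le> ?t" by simp
    from level_times.yule_cdf_concentrated[OF \<tau> this, unfolded \<delta>] obtain \<kappa> :: nat where
      up: "\<And>k. 1 - yule_cdf (Suc k) ?t \<le> 1 / (1 / 3) * exp (- \<delta> * (real k - real \<kappa>))" and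
      lo: "\<And>k. yule_cdf (Suc k) ?t \<le> exp \<gamma> * exp (- \<gamma> * (real \<kappa> - real k))"
      by blast
    have "1 - height_cdf 1 m k \<le> A * exp (- \<delta> * (real k - real \<kappa>))" for k
    proof (cases k)
      case 0
      have "1 - height_cdf 1 m k \<le> 1 * 1 * 1 * 1" using 0 by (simp add: height_cdf_0)
      also have "\<dots> \<le> A * exp (- \<delta> * (real k - real \<kappa>))"
        unfolding A_def using 0 \<delta>(3) by (intro mult_mono) auto
      finally show ?thesis .
    next
      case (Suc k')
      have "1 - height_cdf 1 m k \<le> exp 1 * (1 - yule_cdf (Suc k') ?t)"
        unfolding Suc by (rule height_tail_upper)
      also have "\<dots> \<le> exp 1 * (1 / (1 / 3) * exp (- \<delta> * (real k' - real \<kappa>)))"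
        by (intro mult_left_mono up) auto
      also have "exp (- \<delta> * (real k' - real \<kappa>)) = exp \<delta> * exp (- \<delta> * (real k - real \<kappa>))"
        unfolding exp_add[symmetric] by (simp add: Suc algebra_simps)
      finally show ?thesis by (simp add: A_def)
    qed
    moreover have "height_cdf (real r) m (Suc k) \<le> B * real r ^ r * exp (- \<gamma> * (real \<kappa> - real k))"
      if "0 < r" for r k
    proof -
      have "height_cdf (real r) m (Suc k) \<le> exp 1 * real r ^ r * yule_cdf (Suc k) ?t"
        by (rule height_tail_lower[OF that])
      also have "\<dots> \<le> exp 1 * real r ^ r * (exp \<gamma> * exp (- \<gamma> * (real \<kappa> - real k)))"
        by (intro mult_left_mono lo) auto
      finally show ?thesis by (simp add: B_def mult_ac)
    qed
    ultimately show ?thesis by blast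
  qed
  moreover have "0 < A" "0 < B" by (simp_all add: A_def B_def)
  ultimately show thesis using that[of A B] by (simp add: \<delta>_def \<gamma>_def)
qed

section \<open>The mean height of the random recursive tree\<close>

lemma sum_exp_le:
  assumes "0 < c"
  shows "(\<Sum>i<n. exp (- c * real i)) \<le> 1 / (1 - exp (- c))"
proof -
  have eq: "exp (- c * real i) = exp (- c) ^ i" for i
    by (subst exp_of_nat_mult[symmetric]) (simp add: mult.commute)
  have "(\<Sum>i<n. exp (- c) ^ i) \<le> (\<Sum>i. exp (- c) ^ i)"
    using assms by (intro sum_le_suminf summable_geometric) auto
  also have "\<dots> = 1 / (1 - exp (- c))" using assms by (intro suminf_geometric) auto
  finally show ?thesis by (simp only: eq)
qed

text \<open>The tail sum formula for the mean; it may stop at any \<open>N \<ge> m\<close> because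
  the height is at most \<open>m\<close>.\<close>

lemma rrt_mean_height_sum:
  assumes "m \<le> N"
  shows "rrt_mean_height (Suc m) = (\<Sum>k<N. 1 - height_cdf 1 m (Suc k))"
proof -
  have "rrt_mean_height (Suc m) = hoppe_mean 1 m (\<lambda>ps. real (tree_height (Suc m) ps))"
    by (simp add: rrt_mean_height_def hoppe_height_def)
  also have "\<dots> = hoppe_mean 1 m (\<lambda>ps. \<Sum>k<N. 1 - of_bool (below (Suc k) ps))"
  proof (rule hoppe_mean_cong)
    fix ps assume ps: "ps \<in> parent_lists m"
    define h where "h = tree_height (Suc m) ps"
    have below: "below k ps \<longleftrightarrow> h < k" for k
      using tree_height_less_iff[of ps k] length_parent_lists[OF ps] by (simp add: h_def)
    have "h \<le> N" using below_large[OF ps] below assms by simp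
    have "(\<Sum>k<N. 1 - of_bool (below (Suc k) ps)) = (\<Sum>k<N. of_bool (k \<in> {..<h}) :: real)"
      by (intro sum.cong) (auto simp: below)
    also have "\<dots> = real (card ({..<N} \<inter> {..<h}))" by (simp add: lessThan_def)
    also have "{..<N} \<inter> {..<h} = {..<h}" using \<open>h \<le> N\<close> by auto
    finally show "real (tree_height (Suc m) ps) = (\<Sum>k<N. 1 - of_bool (below (Suc k) ps))"
      by (simp add: h_def)
  qed simp
  also have "\<dots> = (\<Sum>k<N. hoppe_mean 1 m (\<lambda>ps. 1 - of_bool (below (Suc k) ps)))"
    by (simp add: hoppe_mean_sum sum_distrib_left sum.swap[of _ "{..<N}"])
  also have "\<dots> = (\<Sum>k<N. 1 - height_cdf 1 m (Suc k))"
  proof (rule sum.cong)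
    fix k
    have "(\<Sum>ps\<in>parent_lists m. pmf (hoppe_parents 1 m) ps) = 1"
      using hoppe_mean_sum[of 1 m "\<lambda>_. 1"] by simp
    then show "hoppe_mean 1 m (\<lambda>ps. 1 - of_bool (below (Suc k) ps)) = 1 - height_cdf 1 m (Suc k)"
      by (simp add: height_cdf_def hoppe_mean_sum right_diff_distrib sum_subtractf)
  qed simp
  finally show ?thesis .
qed

lemma sum_lessThan_add:
  fixes f :: "nat \<Rightarrow> real"
  shows "(\<Sum>k<a + b. f k) = (\<Sum>k<a. f k) + (\<Sum>i<b. f (a + i))"
  by (induction b) auto

text \<open>In the tail sum, the levels below \<open>\<kappa>\<close> contribute
  \<open>\<kappa>\<close> up to a geometric series of defects, and the levels from
  \<open>\<kappa>\<close> on another geometric series.\<close>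

lemma rrt_mean_height_close:
  fixes \<kappa> :: nat
  assumes "0 < c" "0 < d" "0 \<le> A" "0 \<le> B"
    and up: "\<And>k. 1 - height_cdf 1 m k \<le> A * exp (- c * (real k - real \<kappa>))"
    and lo: "\<And>k. height_cdf 1 m (Suc k) \<le> B * exp (- d * (real \<kappa> - real k))"
  shows "\<bar>rrt_mean_height (Suc m) - real \<kappa>\<bar> \<le> A / (1 - exp (- c)) + B / (1 - exp (- d))"
proof -
  define u where "u = (\<lambda>k. 1 - height_cdf 1 m (Suc k))"
  have u: "0 \<le> u k" "u k \<le> 1" for k
    by (simp_all add: u_def height_cdf_bounds)
  have M: "rrt_mean_height (Suc m) = (\<Sum>k<\<kappa>. u k) + (\<Sum>i<m. u (\<kappa> + i))"
    using rrt_mean_height_sum[of m "\<kappa> + m"] by (simp add: u_def sum_lessThan_add)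
  have "(\<Sum>i<m. u (\<kappa> + i)) \<le> (\<Sum>i<m. A * exp (- c * real i))"
  proof (rule sum_mono)
    fix i
    have "u (\<kappa> + i) \<le> A * exp (- c * real (Suc i))"
      using up[of "Suc (\<kappa> + i)"] by (simp add: u_def add.commute)
    also have "\<dots> \<le> A * exp (- c * real i)"
      using assms by (intro mult_left_mono) auto
    finally show "u (\<kappa> + i) \<le> A * exp (- c * real i)" .
  qed
  also have "\<dots> \<le> A * (1 / (1 - exp (- c)))"
    unfolding sum_distrib_left[symmetric] using assms by (intro mult_left_mono sum_exp_le) auto
  finally have tail: "(\<Sum>i<m. u (\<kappa> + i)) \<le> A / (1 - exp (- c))" by simp
  \<comment> \<open>Reversed, so that the defects are indexed by their distance to
    \<open>\<kappa>\<close>.\<close>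
  have "(\<Sum>k<\<kappa>. 1 - u k) = (\<Sum>i<\<kappa>. 1 - u (\<kappa> - Suc i))"
    by (rule sum.nat_diff_reindex[symmetric])
  also have "\<dots> \<le> (\<Sum>i<\<kappa>. B * exp (- d * real i))"
  proof (rule sum_mono)
    fix i assume i: "i \<in> {..<\<kappa>}"
    have "1 - u (\<kappa> - Suc i) \<le> B * exp (- d * real (Suc i))"
      using lo[of "\<kappa> - Suc i"] i by (simp add: u_def of_nat_diff)
    also have "\<dots> \<le> B * exp (- d * real i)"
      using assms by (intro mult_left_mono) auto
    finally show "1 - u (\<kappa> - Suc i) \<le> B * exp (- d * real i)" .
  qed
  also have "\<dots> \<le> B * (1 / (1 - exp (- d)))"
    unfolding sum_distrib_left[symmetric] using assms by (intro mult_left_mono sum_exp_le) auto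
  finally have head: "real \<kappa> - (\<Sum>k<\<kappa>. u k) \<le> B / (1 - exp (- d))"
    by (simp add: sum_subtractf)
  have "(\<Sum>k<\<kappa>. u k) \<le> (\<Sum>k<\<kappa>. 1)" by (intro sum_mono u)
  moreover have "0 \<le> (\<Sum>i<m. u (\<kappa> + i))" by (intro sum_nonneg u)
  moreover have "0 \<le> A / (1 - exp (- c))" "0 \<le> B / (1 - exp (- d))" using assms by auto
  ultimately show ?thesis using tail head unfolding M by (simp add: abs_le_iff)
qed

section \<open>Tail bounds around the mean for all root weights\<close>

text \<open>At the price of one level the bound is uniform in \<open>\<theta>\<close>, so the
  constant of the upper tail does not depend on it.\<close>

lemma height_cdf_compare:
  assumes "0 < \<theta>"
  shows "height_cdf 1 m k \<le> height_cdf \<theta> m (Suc k)"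
proof (cases m)
  case 0
  then show ?thesis
    using height_cdf_1[OF assms, of 0 "Suc k"] height_cdf_bounds(2)[of 1 m k] by simp
next
  case (Suc i)
  have "height_cdf 1 (Suc i) k \<le> height_cdf 1 i k" by (rule height_cdf_Suc_le) simp
  also have "\<dots> \<le> height_cdf \<theta> (Suc i) (Suc k)" by (rule height_cdf_theta_lower[OF assms])
  finally show ?thesis by (simp add: Suc)
qed

theorem theorem2p3:
  shows "(\<forall>\<beta>::real. \<beta> < 1 / (2 * exp 1) \<longrightarrow>
            (\<exists>C\<beta>>0. \<forall>\<theta>::real. \<theta> > 0 \<longrightarrow> (\<forall>n::nat. n \<ge> 1 \<longrightarrow> (\<forall>t::real. t > 0 \<longrightarrow>
               measure_pmf.prob (hoppe_height \<theta> n) {h. real h - rrt_mean_height n \<ge> t}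
                 \<le> C\<beta> * exp (- \<beta> * t)))))
       \<and> (\<forall>\<theta>::real. \<theta> > 0 \<longrightarrow> (\<forall>\<alpha>::real. \<alpha> < 1 / (3 * exp 1) \<longrightarrow>
            (\<exists>C\<alpha>>0. \<forall>n::nat. n \<ge> 1 \<longrightarrow> (\<forall>t::real. t > 0 \<longrightarrow>
               measure_pmf.prob (hoppe_height \<theta> n) {h. real h - rrt_mean_height n \<le> - t}
                 \<le> C\<alpha> * exp (- \<alpha> * t)))))"
proof -
  define \<delta> \<gamma> where "\<delta> = 2 / (3 * exp 1 :: real)" and "\<gamma> = 4 / (9 * exp 1 :: real)"
  have \<delta>\<gamma>: "0 < \<delta>" "0 < \<gamma>" "1 / (2 * exp 1) \<le> \<delta>" "1 / (3 * exp 1) \<le> \<gamma>"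
    by (auto simp: \<delta>_def \<gamma>_def field_simps)
  obtain A B :: real where AB: "0 < A" "0 < B" and
    "\<And>m. \<exists>\<kappa>::nat. \<forall>k. 1 - height_cdf 1 m k \<le> A * exp (- \<delta> * (real k - real \<kappa>)) \<and>
      (\<forall>r>0. height_cdf (real r) m (Suc k) \<le> B * real r ^ r * exp (- \<gamma> * (real \<kappa> - real k)))"
    using height_concentrated unfolding \<delta>_def[symmetric] \<gamma>_def[symmetric] by metis
  then obtain \<kappa> :: "nat \<Rightarrow> nat" where
    up: "\<And>m k. 1 - height_cdf 1 m k \<le> A * exp (- \<delta> * (real k - real (\<kappa> m)))" and
    lo: "\<And>m k r. 0 < r \<Longrightarrow>
      height_cdf (real r) m (Suc k) \<le> B * real r ^ r * exp (- \<gamma> * (real (\<kappa> m) - real k))"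
    by metis
  define C where "C = A / (1 - exp (- \<delta>)) + B / (1 - exp (- \<gamma>))"
  have C: "\<bar>rrt_mean_height (Suc m) - real (\<kappa> m)\<bar> \<le> C" for m
    unfolding C_def
    by (rule rrt_mean_height_close) (use \<delta>\<gamma> AB up lo[of 1] in auto)
  have M_nonneg: "0 \<le> rrt_mean_height n" for n
    by (simp add: rrt_mean_height_def)
  have upper: "measure_pmf.prob (hoppe_height \<theta> (Suc m)) {h. real h - rrt_mean_height (Suc m) \<ge> t}
      \<le> A * exp (\<delta> * (C + 1)) * exp (- \<beta> * t)"
    if "\<beta> < 1 / (2 * exp 1)" "0 < \<theta>" "0 < t" for \<beta> \<theta> t m
  proof -
    define x where "x = rrt_mean_height (Suc m) + t"
    \<comment> \<open>Positivity of \<open>x\<close> makes the integer threshold a successor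
      \<open>Suc k\<close>, as the comparison of root weights demands.\<close>
    have "0 < x" using that M_nonneg[of "Suc m"] by (simp add: x_def)
    then have "0 < nat \<lceil>x\<rceil>" by simp
    then obtain k where k: "nat \<lceil>x\<rceil> = Suc k" by (cases "nat \<lceil>x\<rceil>") auto
    have x_le: "x \<le> real (Suc k)" using k by linarith
    have "{h. real h - rrt_mean_height (Suc m) \<ge> t} = - {h. h < Suc k}"
      using k by (auto simp: x_def) linarith+
    then have "measure_pmf.prob (hoppe_height \<theta> (Suc m)) {h. real h - rrt_mean_height (Suc m) \<ge> t}
        = 1 - height_cdf \<theta> m (Suc k)"
      using measure_pmf.prob_compl[of "{h. h < Suc k}" "hoppe_height \<theta> (Suc m)"]
      by (simp add: prob_hoppe_height[OF that(2)] Compl_eq_Diff_UNIV)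
    also have "\<dots> \<le> 1 - height_cdf 1 m k"
      using height_cdf_compare[OF that(2)] by simp
    also have "\<dots> \<le> A * exp (- \<delta> * (real k - real (\<kappa> m)))" by (rule up)
    also have "\<dots> \<le> A * exp (\<delta> * (C + 1) - \<delta> * t)"
    proof -
      \<comment> \<open>\<open>C\<close> bounds the distance of the mean to the centre; the extra 1
        is the level lost in \<open>height_cdf_compare\<close>.\<close>
      have "t - (C + 1) \<le> real k - real (\<kappa> m)"
        using C[of m] x_le by (simp add: x_def abs_le_iff)
      then have "\<delta> * (t - (C + 1)) \<le> \<delta> * (real k - real (\<kappa> m))"
        using \<delta>\<gamma> by (intro mult_left_mono) auto
      then show ?thesis using AB by (simp add: algebra_simps)
    qed
    also have "\<dots> \<le> A * exp (\<delta> * (C + 1) - \<beta> * t)"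
      using AB \<delta>\<gamma> that by (intro mult_left_mono) auto
    finally show ?thesis by (simp add: exp_diff exp_minus field_simps)
  qed
  have lower: "measure_pmf.prob (hoppe_height \<theta> (Suc m)) {h. real h - rrt_mean_height (Suc m) \<le> - t}
      \<le> B * real r ^ r * exp (\<gamma> * C) * exp (- \<alpha> * t)"
    if "\<alpha> < 1 / (3 * exp 1)" "0 < \<theta>" "0 < t" "0 < r" "\<theta> \<le> real r" for \<alpha> \<theta> t m r
  \<comment> \<open>Heights are nonnegative, so a negative threshold makes the event empty.\<close>
  proof (cases "rrt_mean_height (Suc m) - t < 0")
    case True
    then have "{h. real h - rrt_mean_height (Suc m) \<le> - t} = {}" by auto
    then show ?thesis using AB by simp
  next
    case False
    define x where "x = rrt_mean_height (Suc m) - t"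
    define k where "k = nat \<lfloor>x\<rfloor>"
    have "0 \<le> x" using False by (simp add: x_def)
    then have k: "real k \<le> x" "x < real k + 1" unfolding k_def by linarith+
    have "{h. real h - rrt_mean_height (Suc m) \<le> - t} \<subseteq> {h. h < Suc k}"
      using k(2) by (auto simp: x_def)
    then have "measure_pmf.prob (hoppe_height \<theta> (Suc m)) {h. real h - rrt_mean_height (Suc m) \<le> - t}
        \<le> measure_pmf.prob (hoppe_height \<theta> (Suc m)) {h. h < Suc k}"
      by (intro measure_pmf.finite_measure_mono) auto
    also have "\<dots> = height_cdf \<theta> m (Suc k)" by (rule prob_hoppe_height[OF that(2)])
    also have "\<dots> \<le> height_cdf (real r) m (Suc k)" by (rule height_cdf_theta_mono) (use that in auto)
    also have "\<dots> \<le> B * real r ^ r * exp (- \<gamma> * (real (\<kappa> m) - real k))" by (rule lo[OF that(4)])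
    also have "\<dots> \<le> B * real r ^ r * exp (\<gamma> * C - \<gamma> * t)"
    proof -
      have "t - C \<le> real (\<kappa> m) - real k"
        using C[of m] k(1) by (simp add: x_def abs_le_iff)
      then have "\<gamma> * (t - C) \<le> \<gamma> * (real (\<kappa> m) - real k)"
        using \<delta>\<gamma> by (intro mult_left_mono) auto
      then show ?thesis using AB by (intro mult_left_mono) (auto simp: algebra_simps)
    qed
    also have "\<dots> \<le> B * real r ^ r * exp (\<gamma> * C - \<alpha> * t)"
      using AB \<delta>\<gamma> that by (intro mult_left_mono) auto
    also have "\<dots> = B * real r ^ r * exp (\<gamma> * C) * exp (- \<alpha> * t)"
      by (simp add: exp_diff exp_minus field_simps)
    finally show ?thesis .
  qed
  show ?thesis
  proof (intro conjI allI impI)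
    fix \<beta> :: real assume \<beta>: "\<beta> < 1 / (2 * exp 1)"
    show "\<exists>C\<beta>>0. \<forall>\<theta>::real. \<theta> > 0 \<longrightarrow> (\<forall>n::nat. n \<ge> 1 \<longrightarrow> (\<forall>t::real. t > 0 \<longrightarrow>
        measure_pmf.prob (hoppe_height \<theta> n) {h. real h - rrt_mean_height n \<ge> t} \<le> C\<beta> * exp (- \<beta> * t)))"
    proof (intro exI[of _ "A * exp (\<delta> * (C + 1))"] conjI allI impI)
      fix \<theta> t :: real and n :: nat assume "0 < \<theta>" "1 \<le> n" "0 < t"
      then show "measure_pmf.prob (hoppe_height \<theta> n) {h. real h - rrt_mean_height n \<ge> t}
          \<le> A * exp (\<delta> * (C + 1)) * exp (- \<beta> * t)"
        using upper[OF \<beta>, of \<theta> t "n - 1"] by simp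
    qed (use AB in simp)
  next
    fix \<theta> \<alpha> :: real assume \<theta>: "0 < \<theta>" and \<alpha>: "\<alpha> < 1 / (3 * exp 1)"
    \<comment> \<open>An integer weight dominating \<open>\<theta>\<close>; through \<open>r\<close>
      the constant of the lower tail depends on \<open>\<theta>\<close>.\<close>
    define r where "r = nat \<lceil>\<theta>\<rceil>"
    have r: "0 < r" "\<theta> \<le> real r" using \<theta> by (simp_all add: r_def)
    show "\<exists>C\<alpha>>0. \<forall>n::nat. n \<ge> 1 \<longrightarrow> (\<forall>t::real. t > 0 \<longrightarrow>
        measure_pmf.prob (hoppe_height \<theta> n) {h. real h - rrt_mean_height n \<le> - t} \<le> C\<alpha> * exp (- \<alpha> * t))"
    proof (intro exI[of _ "B * real r ^ r * exp (\<gamma> * C)"] conjI allI impI)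
      fix t :: real and n :: nat assume "1 \<le> n" "0 < t"
      then show "measure_pmf.prob (hoppe_height \<theta> n) {h. real h - rrt_mean_height n \<le> - t}
          \<le> B * real r ^ r * exp (\<gamma> * C) * exp (- \<alpha> * t)"
        using lower[OF \<alpha> \<theta> _ r, of t "n - 1"] by simp
    qed (use AB r in simp)
  qed
qed

end
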